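(* Let $v$ be an even positive integer. There exists a propus parameter set $(v;x,y,y,z;\lambda)$ with $0\le x,y,z\le v/2$, i.e. nonnegative integers $x,y,z\le v/2$ and $\lambda\ge 0$ with $$x(x-1)+2y(y-1)+z(z-1)=\lambda(v-1)\quad\text{and}\quad \lambda=x+2y+z-v,$$ if and only if $v$ is not of the form $2^{2k+1}(8m+7)$ with $k,m$ nonnegative integers.
   Context: A GS-parameter set is a tuple $(v;k_1,k_2,k_3,k_4;\lambda)$ of nonnegative integers, with $v\ge 1$, satisfying $\sum_{i=1}^4 k_i(k_i-1)=\lambda(v-1)$ and $\lambda=\sum_{i=1}^4 k_i-v$. A propus parameter set is a GS-parameter set with $k_2=k_3$; it is written $(v;x,y,y,z;\lambda)$ with $x=k_1$, $y=k_2=k_3$, $z=k_4$. *)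

theory Defs
  imports Main
begin

text \<open>
  The entries are natural numbers, but the two equations are stated over the integers:
  on \<^typ>\<open>nat\<close> the subtraction in the second one would truncate, so that it could
  hold with \<open>\<lambda> = 0\<close> whenever \<open>\<Sum>k\<^sub>i < v\<close>.
\<close>

definition GS_parameter_set ::
    "nat \<Rightarrow> nat \<Rightarrow> nat \<Rightarrow> nat \<Rightarrow> nat \<Rightarrow> nat \<Rightarrow> bool" where
  "GS_parameter_set v k1 k2 k3 k4 l \<longleftrightarrow>
     1 \<le> v \<and>
     int k1 * (int k1 - 1) + int k2 * (int k2 - 1) + int k3 * (int k3 - 1)
       + int k4 * (int k4 - 1) = int l * (int v - 1) \<and>
     int l = int k1 + int k2 + int k3 + int k4 - int v"

definition propus_parameter_set ::
    "nat \<Rightarrow> nat \<Rightarrow> nat \<Rightarrow> nat \<Rightarrow> nat \<Rightarrow> bool" where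
  "propus_parameter_set v x y z l \<longleftrightarrow> GS_parameter_set v x y y z l"

end

theory Submission
  imports Defs
    "HOL-Analysis.Infinite_Sum"
    "HOL-Analysis.Summation_Tests"
    "HOL-Real_Asymp.Real_Asymp"
    "HOL-Computational_Algebra.Squarefree"
    "HOL-Number_Theory.Number_Theory"
begin

text \<open>
  With \<open>v = 2 w\<close>, completing squares reduces the claim to Legendre's three-square theorem for
  \<open>w\<close>. A squarefree \<open>n\<close> not congruent to 7 modulo 8 is a rational sum of three squares, hence
  an integral one by the descent of Aubry and Davenport--Cassels: choose a prime \<open>p\<close> congruent
  to 1 modulo 4 such that \<open>m = p\<close> (or \<open>m = 2 p\<close>, if \<open>n\<close> is 3 modulo 8) makes
  \<open>n t\<^sup>2 = z\<^sup>2 + m w\<^sup>2\<close> solvable by Legendre's criterion, and write \<open>m\<close> as a sum of two squares.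
  Only Legendre symbols of \<open>p\<close> have to be prescribed, so Dirichlet's theorem is needed for
  real characters only. There \<open>L(1, \<chi>) \<noteq> 0\<close> has an elementary proof by Monsky.
\<close>

section \<open>From rational to integral sums of squares\<close>

text \<open>That \<open>n\<close> is a square modulo \<open>p\<close> is not prescribed but follows.
  Making \<open>- m\<close> a square modulo every odd prime \<open>q\<close> dividing
  \<open>n\<close> fixes the symbol of \<open>p\<close> at \<open>q\<close>, and since
  \<open>p\<close> is 1 modulo 4, reciprocity carries the product of these symbols over to
  \<open>p\<close>. For odd \<open>n\<close> and \<open>m = p\<close> the result is (-1/n), which is
  1 only for \<open>n\<close> congruent to 1 modulo 4; \<open>m = 2 p\<close> gives (-2/n), which
  repairs 3 modulo 8, while 7 modulo 8 fails for both. For even \<open>n\<close> the symbol of 2 at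
  \<open>p\<close> is still free and absorbs the sign. Squarefreeness lets the condition modulo
  \<open>n\<close> be checked prime by prime. The conditions on \<open>p\<close> are independent
  signs, so the characters that separate them are products of quadratic symbols and hence real. Real
  characters have nonnegative divisor sums, and Monsky's argument rests on this positivity.\<close>

lemma nearest_multiple:
  fixes x t :: int
  assumes "t \<noteq> 0"
  obtains q where "2 * \<bar>x - t * q\<bar> \<le> \<bar>t\<bar>"
proof -
  have *: "\<exists>q. 2 * \<bar>x - t * q\<bar> \<le> t" if "t > 0" for t :: int
  proof -
    \<comment> \<open>\<open>x / t\<close> rounded to the nearest integer, that is the floor of
      \<open>x / t + 1 / 2\<close>.\<close>
    define q where "q = (2 * x + t) div (2 * t)"
    define r where "r = (2 * x + t) mod (2 * t)"
    have "2 * x + t = 2 * (t * q) + r"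
      unfolding q_def r_def by (metis mult.assoc mult_div_mod_eq)
    moreover have "0 \<le> r" "r < 2 * t"
      unfolding r_def using that by simp_all
    ultimately have "2 * \<bar>x - t * q\<bar> \<le> t"
      by (simp add: abs_if)
    then show ?thesis ..
  qed
  show ?thesis
  proof (cases "t > 0")
    case True
    then show ?thesis using * that by fastforce
  next
    case False
    then obtain q where "2 * \<bar>x - (- t) * q\<bar> \<le> - t"
      using *[of "- t"] assms by auto
    then show ?thesis using that[of "- q"] False by auto
  qed
qed

text \<open>The line through the rational point \<open>(x, y, z) / t\<close> of the sphere and the
  nearest integral point \<open>(x', y', z')\<close> meets the sphere again, in a point with
  denominator \<open>T\<close> where \<open>t * T = d\<close>. Three squares of at most 1/4 sum to
  less than 1, so \<open>d < t^2\<close> and the denominator shrinks.\<close>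

lemma three_squares_of_rational:
  fixes n t x y z :: int
  assumes "n * t\<^sup>2 = x\<^sup>2 + y\<^sup>2 + z\<^sup>2" "t \<noteq> 0"
  shows "\<exists>a b c :: int. n = a\<^sup>2 + b\<^sup>2 + c\<^sup>2"
  using assms
proof (induction "nat \<bar>t\<bar>" arbitrary: t x y z rule: less_induct)
  case less
  obtain x' where x': "2 * \<bar>x - t * x'\<bar> \<le> \<bar>t\<bar>" using nearest_multiple less.prems(2) by blast
  obtain y' where y': "2 * \<bar>y - t * y'\<bar> \<le> \<bar>t\<bar>" using nearest_multiple less.prems(2) by blast
  obtain z' where z': "2 * \<bar>z - t * z'\<bar> \<le> \<bar>t\<bar>" using nearest_multiple less.prems(2) by blast
  define d where "d = (x - t * x')\<^sup>2 + (y - t * y')\<^sup>2 + (z - t * z')\<^sup>2"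
  have sq: "4 * u\<^sup>2 \<le> t\<^sup>2" if "2 * \<bar>u\<bar> \<le> \<bar>t\<bar>" for u :: int
    using power_mono[OF that, of 2] by (simp add: power_mult_distrib)
  have t2: "t\<^sup>2 > 0" using less.prems(2) by simp
  have d_less: "d < t\<^sup>2"
    using sq[OF x'] sq[OF y'] sq[OF z'] t2 unfolding d_def by linarith
  \<comment> \<open>In homogeneous coordinates the form \<open>x^2 + y^2 + z^2 - n t^2\<close>
    vanishes at \<open>(x, y, z, t)\<close> and has value \<open>a\<close> at
    \<open>(x', y', z', 1)\<close>. With \<open>b\<close> minus twice the bilinear product of these
    two points, it also vanishes at \<open>a\<close> times the first plus \<open>b\<close> times the
    second, whose last coordinate is \<open>T\<close>.\<close>
  define a where "a = x'\<^sup>2 + y'\<^sup>2 + z'\<^sup>2 - n"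
  define b where "b = 2 * (n * t - x * x' - y * y' - z * z')"
  define T where "T = a * t + b"
  have "d = t * T + (x\<^sup>2 + y\<^sup>2 + z\<^sup>2 - n * t\<^sup>2)"
    unfolding T_def a_def b_def d_def by (simp add: power2_eq_square algebra_simps)
  then have tT: "t * T = d" using less.prems(1) by simp
  show ?case
  proof (cases "d = 0")
    case True
    then have "T = 0" using tT less.prems(2) by simp
    have "(x - t * x')\<^sup>2 = 0" "(y - t * y')\<^sup>2 = 0" "(z - t * z')\<^sup>2 = 0"
      using True unfolding d_def
      by (smt (verit) zero_le_power2)+
    then have "x = t * x'" "y = t * y'" "z = t * z'" by simp_all
    then have "t\<^sup>2 * n = t\<^sup>2 * (x'\<^sup>2 + y'\<^sup>2 + z'\<^sup>2)"
      using less.prems(1) by (simp add: algebra_simps power_mult_distrib)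
    then show ?thesis using t2 by auto
  next
    case False
    have T0: "T \<noteq> 0" using False tT by auto
    have "d \<ge> 0" unfolding d_def by simp
    then have "\<bar>t\<bar> * \<bar>T\<bar> < \<bar>t\<bar> * \<bar>t\<bar>"
      using d_less tT by (simp flip: abs_mult add: power2_eq_square)
    then have lt: "nat \<bar>T\<bar> < nat \<bar>t\<bar>"
      using less.prems(2) by (metis abs_ge_zero mult_less_cancel_left_disj nat_mono_iff not_less zero_less_abs_iff)
    have "n * T\<^sup>2 = (a * x + b * x')\<^sup>2 + (a * y + b * y')\<^sup>2 + (a * z + b * z')\<^sup>2"
    proof -
      have "(a * x + b * x')\<^sup>2 + (a * y + b * y')\<^sup>2 + (a * z + b * z')\<^sup>2
          = a\<^sup>2 * (x\<^sup>2 + y\<^sup>2 + z\<^sup>2) + a * b * (2 * (x * x' + y * y' + z * z'))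
            + b\<^sup>2 * (x'\<^sup>2 + y'\<^sup>2 + z'\<^sup>2)"
        by (simp add: power2_eq_square algebra_simps)
      also have "2 * (x * x' + y * y' + z * z') = 2 * n * t - b"
        by (simp add: b_def)
      also have "x'\<^sup>2 + y'\<^sup>2 + z'\<^sup>2 = a + n"
        by (simp add: a_def)
      also have "x\<^sup>2 + y\<^sup>2 + z\<^sup>2 = n * t\<^sup>2"
        using less.prems(1) by simp
      finally show ?thesis
        by (simp add: T_def power2_eq_square algebra_simps)
    qed
    then show ?thesis using less.hyps[OF lt _ T0] by blast
  qed
qed

section \<open>Integral solutions of quadratic forms by the pigeonhole principle\<close>

lemma floor_sqrt_int:
  fixes k :: int
  assumes "k \<ge> 0"
  obtains r :: int where "r \<ge> 0" "r\<^sup>2 \<le> k" "k < (r + 1)\<^sup>2"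
proof -
  let ?r = "\<lfloor>sqrt (real_of_int k)\<rfloor>"
  have r0: "?r \<ge> 0" using assms by simp
  have "(real_of_int ?r)\<^sup>2 \<le> (sqrt (real_of_int k))\<^sup>2"
    using r0 by (intro power_mono) auto
  then have "real_of_int (?r\<^sup>2) \<le> real_of_int k" using assms by simp
  moreover have "(sqrt (real_of_int k))\<^sup>2 < (real_of_int ?r + 1)\<^sup>2"
    using assms by (intro power_strict_mono) auto
  then have "real_of_int k < real_of_int ((?r + 1)\<^sup>2)" using assms by simp
  ultimately show ?thesis using that r0 by (simp only: of_int_le_iff of_int_less_iff)
qed

lemma abs_diff_le_square:
  fixes u v r k :: int
  assumes "u \<in> {0..r}" "v \<in> {0..r}" "r\<^sup>2 \<le> k"
  shows "(u - v)\<^sup>2 \<le> k"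
proof -
  have "\<bar>u - v\<bar>\<^sup>2 \<le> r\<^sup>2" using assms by (intro power_mono) auto
  then show ?thesis using assms by simp
qed

text \<open>
  Legendre's criterion for \<open>z\<^sup>2 + m w\<^sup>2 - n t\<^sup>2\<close>: the two congruence conditions cut out
  a lattice of index \<open>m n\<close> on which the form is divisible by \<open>m n\<close>, and the pigeonhole
  principle provides a nonzero lattice point where it lies strictly between \<open>- m n\<close> and
  \<open>2 m n\<close>. The value \<open>m n\<close> is removed by composing with \<open>t\<^sup>2 + m\<close>.
\<close>

lemma legendre_ternary:
  fixes m n \<alpha> \<beta> :: int
  assumes pos: "m > 0" "n > 0" and cop: "coprime m n"
    and \<alpha>: "m dvd \<alpha>\<^sup>2 - n" and \<beta>: "n dvd \<beta>\<^sup>2 + m" and nonsq: "\<And>k. k\<^sup>2 \<noteq> m"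
  shows "\<exists>t z w :: int. t \<noteq> 0 \<and> n * t\<^sup>2 = z\<^sup>2 + m * w\<^sup>2"
proof -
  obtain r where r: "r \<ge> 0" "r\<^sup>2 \<le> m * n" "m * n < (r + 1)\<^sup>2"
    using floor_sqrt_int[of "m * n"] pos by auto
  obtain a where a: "a \<ge> 0" "a\<^sup>2 \<le> n" "n < (a + 1)\<^sup>2"
    using floor_sqrt_int[of n] pos by auto
  obtain b where b: "b \<ge> 0" "b\<^sup>2 \<le> m" "m < (b + 1)\<^sup>2"
    using floor_sqrt_int[of m] pos by auto
  let ?S = "{0..r} \<times> {0..a} \<times> {0..b}"
  let ?f = "\<lambda>(z, w, t). ((z - \<alpha> * t) mod m, (z - \<beta> * w) mod n)"
  \<comment> \<open>The sides exceed the square roots of \<open>m * n\<close>, \<open>n\<close> and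
    \<open>m\<close>, so their product exceeds the number \<open>m * n\<close> of residue
    pairs.\<close>
  have "(m * n)\<^sup>2 = (m * n) * (n * m)" by (simp add: power2_eq_square)
  also have "\<dots> < (r + 1)\<^sup>2 * ((a + 1)\<^sup>2 * (b + 1)\<^sup>2)"
    using r a b pos by (intro mult_strict_mono) auto
  also have "\<dots> = ((r + 1) * ((a + 1) * (b + 1)))\<^sup>2" by (simp add: power_mult_distrib)
  finally have big: "m * n < (r + 1) * ((a + 1) * (b + 1))"
    using r a b by (meson power_less_imp_less_base mult_nonneg_nonneg add_nonneg_nonneg zero_le_one)
  have "card (?f ` ?S) \<le> card ({0..<m} \<times> {0..<n})"
    using pos by (intro card_mono) auto
  also have "\<dots> = nat (m * n)" using pos by (simp add: nat_mult_distrib)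
  also have "\<dots> < nat ((r + 1) * ((a + 1) * (b + 1)))" 
    using big pos by (subst nat_less_eq_zless) auto
  also have "\<dots> = card ?S" using r a b by (simp add: nat_mult_distrib)
  finally have "\<not> inj_on ?f ?S" by (rule pigeonhole)
  then obtain z1 w1 t1 z2 w2 t2 where
    mem: "z1 \<in> {0..r}" "z2 \<in> {0..r}" "w1 \<in> {0..a}" "w2 \<in> {0..a}" "t1 \<in> {0..b}" "t2 \<in> {0..b}"
    and ne: "(z1, w1, t1) \<noteq> (z2, w2, t2)"
    and eqm: "(z1 - \<alpha> * t1) mod m = (z2 - \<alpha> * t2) mod m"
    and eqn: "(z1 - \<beta> * w1) mod n = (z2 - \<beta> * w2) mod n"
    unfolding inj_on_def by auto
  define z where "z = z1 - z2"
  define w where "w = w1 - w2"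
  define t where "t = t1 - t2"
  have "m dvd (z1 - \<alpha> * t1) - (z2 - \<alpha> * t2)" using eqm by (rule mod_eq_dvd_iff[THEN iffD1])
  then have "m dvd z - \<alpha> * t" by (simp add: z_def t_def algebra_simps)
  then have "m dvd (z - \<alpha> * t) * (z + \<alpha> * t) + (\<alpha>\<^sup>2 - n) * t\<^sup>2 + m * w\<^sup>2"
    using \<alpha> by simp
  also have "(z - \<alpha> * t) * (z + \<alpha> * t) + (\<alpha>\<^sup>2 - n) * t\<^sup>2 + m * w\<^sup>2 = z\<^sup>2 + m * w\<^sup>2 - n * t\<^sup>2"
    by (simp add: power2_eq_square algebra_simps)
  finally have dm: "m dvd z\<^sup>2 + m * w\<^sup>2 - n * t\<^sup>2" .
  have "n dvd (z1 - \<beta> * w1) - (z2 - \<beta> * w2)" using eqn by (rule mod_eq_dvd_iff[THEN iffD1])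
  then have "n dvd z - \<beta> * w" by (simp add: z_def w_def algebra_simps)
  then have "n dvd (z - \<beta> * w) * (z + \<beta> * w) + (\<beta>\<^sup>2 + m) * w\<^sup>2 - n * t\<^sup>2"
    using \<beta> by simp
  also have "(z - \<beta> * w) * (z + \<beta> * w) + (\<beta>\<^sup>2 + m) * w\<^sup>2 - n * t\<^sup>2 = z\<^sup>2 + m * w\<^sup>2 - n * t\<^sup>2"
    by (simp add: power2_eq_square algebra_simps)
  finally have dn: "n dvd z\<^sup>2 + m * w\<^sup>2 - n * t\<^sup>2" .
  obtain c where c: "z\<^sup>2 + m * w\<^sup>2 - n * t\<^sup>2 = m * n * c"
    using divides_mult[OF dm dn cop] by (auto elim: dvdE)
  have z2: "z\<^sup>2 \<le> m * n" and w2: "w\<^sup>2 \<le> n" and t2: "t\<^sup>2 \<le> m"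
    unfolding z_def w_def t_def using abs_diff_le_square mem r a b by blast+
  have mw: "m * w\<^sup>2 \<le> m * n" using w2 pos by simp
  have "t\<^sup>2 < m" using t2 nonsq[of t] by simp
  then have "n * t\<^sup>2 < m * n" using pos by (simp add: mult.commute)
  moreover have "z\<^sup>2 \<ge> 0" "m * w\<^sup>2 \<ge> 0" "n * t\<^sup>2 \<ge> 0" using pos by simp_all
  ultimately have "m * n * (-1) < m * n * c" using c by linarith
  then have "c > -1" using pos by (simp only: mult_less_cancel_left) auto
  \<comment> \<open>The value 2 would need \<open>z^2 = m * n\<close> and \<open>w^2 = n\<close> at
    once, which makes \<open>m\<close> a square.\<close>
  have "c < 2"
  proof (rule ccontr)
    assume "\<not> c < 2"
    then have "m * n * 2 \<le> m * n * c" using pos by (intro mult_left_mono) auto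
    then have eq: "z\<^sup>2 = m * n" "m * w\<^sup>2 = m * n"
      using c z2 mw \<open>n * t\<^sup>2 \<ge> 0\<close> by linarith+
    then have "z\<^sup>2 = w\<^sup>2 * m" using pos by simp
    then obtain k where "z = w * k" by (metis dvd_triv_left pow_divides_pow_iff pos2 dvdE)
    moreover have "w \<noteq> 0" using eq pos by auto
    ultimately have "k\<^sup>2 = m" using \<open>z\<^sup>2 = w\<^sup>2 * m\<close> by (simp add: power_mult_distrib)
    then show False using nonsq by blast
  qed
  with \<open>c > -1\<close> consider "c = 0" | "c = 1" by linarith
  then show ?thesis
  proof cases
    case 1
    then have eq: "n * t\<^sup>2 = z\<^sup>2 + m * w\<^sup>2" using c by simp
    have "t \<noteq> 0"
    proof
      assume "t = 0"
      then have "z\<^sup>2 = 0 \<and> m * w\<^sup>2 = 0"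
        using eq add_nonneg_eq_0_iff[OF \<open>z\<^sup>2 \<ge> 0\<close> \<open>m * w\<^sup>2 \<ge> 0\<close>] by simp
      then have "z = 0" "w = 0" using pos by auto
      with \<open>t = 0\<close> ne show False by (simp add: z_def w_def t_def)
    qed
    then show ?thesis using eq by blast
  next
    case 2
    have "n * (t\<^sup>2 + m)\<^sup>2 = (z * t + m * w)\<^sup>2 + m * (z - w * t)\<^sup>2"
    proof -
      have "(z * t + m * w)\<^sup>2 + m * (z - w * t)\<^sup>2 = (z\<^sup>2 + m * w\<^sup>2) * (t\<^sup>2 + m)"
        by (simp add: power2_eq_square algebra_simps)
      also have "z\<^sup>2 + m * w\<^sup>2 = n * (t\<^sup>2 + m)"
        using c 2 by (simp add: algebra_simps)
      finally show ?thesis by (simp add: power2_eq_square mult.assoc)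
    qed
    moreover have "t\<^sup>2 + m \<noteq> 0" using pos by (smt (verit) zero_le_power2)
    ultimately show ?thesis by blast
  qed
qed

lemma square_not_prime:
  fixes r :: int
  assumes "prime p"
  shows "r\<^sup>2 \<noteq> int p"
proof
  assume r: "r\<^sup>2 = int p"
  have "prime_elem (r\<^sup>2)" unfolding r using assms by simp
  then have "prime_elem r \<and> 2 = (1 :: nat)" by (rule prime_elem_power_iff[THEN iffD1])
  then show False by simp
qed

text \<open>Thue's argument: two pairs with entries up to the root of \<open>p\<close> agree under
  \<open>x - k * y\<close> modulo \<open>p\<close>. For their difference, \<open>x^2 + y^2\<close>
  is divisible by \<open>p\<close> and lies strictly between 0 and \<open>2 p\<close>.\<close>

lemma prime_sum_two_squares:
  fixes p :: nat and k :: int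
  assumes p: "prime p" and k: "int p dvd k\<^sup>2 + 1"
  shows "\<exists>c d :: int. int p = c\<^sup>2 + d\<^sup>2"
proof -
  have p0: "int p > 0" using prime_gt_0_nat[OF p] by simp
  obtain r where r: "r \<ge> 0" "r\<^sup>2 \<le> int p" "int p < (r + 1)\<^sup>2"
    using floor_sqrt_int[of "int p"] by auto
  have "r\<^sup>2 \<noteq> int p"
    by (rule square_not_prime[OF p])
  then have r': "r\<^sup>2 \<le> int p - 1" using r by simp
  let ?S = "{0..r} \<times> {0..r}"
  let ?f = "\<lambda>(x, y). (x - k * y) mod int p"
  have "card (?f ` ?S) \<le> card {0..<int p}"
    using p0 by (intro card_mono) auto
  also have "\<dots> < nat ((r + 1)\<^sup>2)" using r by (simp add: nat_less_iff zless_nat_eq_int_zless)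
  also have "\<dots> = card ?S" using r by (simp add: power2_eq_square nat_mult_distrib)
  finally have "\<not> inj_on ?f ?S" by (rule pigeonhole)
  then obtain x1 y1 x2 y2 where
    mem: "x1 \<in> {0..r}" "x2 \<in> {0..r}" "y1 \<in> {0..r}" "y2 \<in> {0..r}"
    and ne: "(x1, y1) \<noteq> (x2, y2)"
    and eq: "(x1 - k * y1) mod int p = (x2 - k * y2) mod int p"
    unfolding inj_on_def by auto
  define x where "x = x1 - x2"
  define y where "y = y1 - y2"
  have "int p dvd (x1 - k * y1) - (x2 - k * y2)" using eq by (rule mod_eq_dvd_iff[THEN iffD1])
  then have "int p dvd x - k * y" by (simp add: x_def y_def algebra_simps)
  then have "int p dvd (x - k * y) * (x + k * y) + (k\<^sup>2 + 1) * y\<^sup>2"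
    using k by simp
  also have "(x - k * y) * (x + k * y) + (k\<^sup>2 + 1) * y\<^sup>2 = x\<^sup>2 + y\<^sup>2"
    by (simp add: power2_eq_square algebra_simps)
  finally obtain c where c: "x\<^sup>2 + y\<^sup>2 = int p * c" by (auto elim: dvdE)
  have "x\<^sup>2 \<le> int p - 1" "y\<^sup>2 \<le> int p - 1"
    unfolding x_def y_def using abs_diff_le_square mem r' by blast+
  then have "int p * c < int p * 2" using c by linarith
  then have "c < 2" using p0 by (simp add: mult_less_cancel_left)
  have "x \<noteq> 0 \<or> y \<noteq> 0" using ne by (auto simp: x_def y_def)
  then have "x\<^sup>2 + y\<^sup>2 > 0" by (simp add: sum_power2_gt_zero_iff)
  then have "c > 0" using c p0 by (simp add: zero_less_mult_iff)
  with \<open>c < 2\<close> have "c = 1" by simp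
  then have "int p = x\<^sup>2 + y\<^sup>2" using c by simp
  then show ?thesis by blast
qed

section \<open>Dirichlet series of real characters\<close>

lemma abel_sum_bound:
  fixes a b :: "nat \<Rightarrow> real"
  assumes A: "\<And>k. \<bar>\<Sum>i<k. a i\<bar> \<le> M" and b: "decseq b" "\<And>i. b i \<ge> 0"
  shows "\<bar>\<Sum>i<k. a i * b i\<bar> \<le> M * b 0"
proof -
  define S where "S k = (\<Sum>i<k. a i)" for k
  have M: "M \<ge> 0" using A[of 0] by simp
  \<comment> \<open>Summation by parts. As \<open>b\<close> decreases, the weights
    \<open>b i - b (Suc i)\<close> are nonnegative and telescope, so only \<open>b 0\<close> enters
    the bound.\<close>
  have eq: "(\<Sum>i<Suc k. a i * b i) = S (Suc k) * b k + (\<Sum>i<k. S (Suc i) * (b i - b (Suc i)))" for k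
    by (induction k) (simp_all add: S_def algebra_simps)
  have bound: "\<bar>\<Sum>i<Suc k. a i * b i\<bar> \<le> M * b 0" for k
  proof -
    have "\<bar>\<Sum>i<Suc k. a i * b i\<bar>
        \<le> \<bar>S (Suc k) * b k\<bar> + (\<Sum>i<k. \<bar>S (Suc i) * (b i - b (Suc i))\<bar>)"
      unfolding eq by (rule order_trans[OF abs_triangle_ineq]) (intro add_left_mono sum_abs)
    also have "\<dots> \<le> M * b k + (\<Sum>i<k. M * (b i - b (Suc i)))"
    proof (intro add_mono sum_mono)
      have *: "\<bar>S j * x\<bar> \<le> M * x" if "x \<ge> 0" for j x
        using that A[of j] by (simp add: S_def abs_mult mult_right_mono)
      show "\<bar>S (Suc k) * b k\<bar> \<le> M * b k" using * b(2) .
      show "\<bar>S (Suc i) * (b i - b (Suc i))\<bar> \<le> M * (b i - b (Suc i))" for i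
        using * decseq_SucD[OF b(1), of i] by simp
    qed
    also have "\<dots> = M * b k + M * (b 0 - b k)"
      unfolding sum_distrib_left[symmetric] sum_lessThan_telescope' ..
    also have "\<dots> = M * b 0"
      by (simp add: algebra_simps)
    finally show ?thesis .
  qed
  show ?thesis
  proof (cases k)
    case 0
    then show ?thesis using M b by simp
  next
    case (Suc k')
    then show ?thesis using bound by blast
  qed
qed

lemma partial_sum_shift_bound:
  fixes a :: "nat \<Rightarrow> real"
  assumes "\<And>k. \<bar>\<Sum>i<k. a i\<bar> \<le> M"
  shows "\<bar>\<Sum>i<k. a (i + m)\<bar> \<le> 2 * M"
proof -
  have "(\<Sum>i<k + m. a i) = (\<Sum>i<m. a i) + (\<Sum>i<k. a (i + m))"
    by (induction k) simp_all
  then show ?thesis using assms[of "k + m"] assms[of m] by linarith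
qed

text \<open>The explicit bound by the first weight is what makes the later estimates uniform in
  \<open>s\<close> near 1 and in the Lambert parameter \<open>t\<close>.\<close>

lemma dirichlet_test:
  fixes a b :: "nat \<Rightarrow> real"
  assumes A: "\<And>k. \<bar>\<Sum>i<k. a i\<bar> \<le> M" and b: "decseq b" "b \<longlonglongrightarrow> 0"
  shows "summable (\<lambda>i. a i * b i)" and "\<bar>\<Sum>i. a i * b i\<bar> \<le> M * b 0"
proof -
  have nonneg: "b i \<ge> 0" for i using decseq_ge[OF b] .
  have tail: "\<bar>sum (\<lambda>i. a i * b i) {m..<n}\<bar> \<le> 2 * M * b m" if "m \<le> n" for m n
  proof -
    have "sum (\<lambda>i. a i * b i) {m..<n} = (\<Sum>i<n - m. a (i + m) * b (i + m))"
      using that sum.shift_bounds_nat_ivl[of "\<lambda>i. a i * b i" 0 m "n - m"]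
      by (simp add: lessThan_atLeast0)
    also have "\<bar>\<dots>\<bar> \<le> 2 * M * b (0 + m)"
      using b(1) nonneg partial_sum_shift_bound[OF A]
      by (intro abel_sum_bound) (auto simp: decseq_def)
    finally show ?thesis by simp
  qed
  show s: "summable (\<lambda>i. a i * b i)"
  proof (rule summable_Cauchy')
    show "\<forall>\<^sub>F m in sequentially. \<forall>n\<ge>m. norm (sum (\<lambda>i. a i * b i) {m..<n}) \<le> 2 * M * b m"
      using tail by simp
    show "(\<lambda>m. 2 * M * b m) \<longlonglongrightarrow> 0"
      using b(2) by (auto intro!: tendsto_eq_intros)
  qed
  have "(\<lambda>k. \<bar>\<Sum>i<k. a i * b i\<bar>) \<longlonglongrightarrow> \<bar>\<Sum>i. a i * b i\<bar>"
    using summable_LIMSEQ[OF s] by (rule tendsto_rabs)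
  then show "\<bar>\<Sum>i. a i * b i\<bar> \<le> M * b 0"
    by (rule LIMSEQ_le_const2) (use abel_sum_bound[OF A b(1) nonneg] in blast)
qed

section \<open>Grouping double series by divisors\<close>

lemma bij_betw_divisor_pairs:
  "bij_betw (\<lambda>(n, d). (d, n div d)) (SIGMA n:{0<..}. {d. d dvd n}) ({0<..} \<times> {0<..} :: (nat \<times> nat) set)"
proof (rule bij_betwI[where g = "\<lambda>(a, b). (a * b, a)"])
  show "(\<lambda>(n, d). (d, n div d)) \<in> (SIGMA n:{0::nat<..}. {d. d dvd n}) \<rightarrow> {0<..} \<times> {0<..}"
    by (auto simp: dvd_def)
qed (auto simp: dvd_def)

lemma infsum_divisor_pairs:
  fixes h :: "nat \<times> nat \<Rightarrow> real"
  assumes "h summable_on {0<..} \<times> {0<..}"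
  shows "infsum h ({0<..} \<times> {0<..}) = (\<Sum>\<^sub>\<infinity>n\<in>{0<..}. \<Sum>d | d dvd n. h (d, n div d))"
    and "(\<lambda>n. \<Sum>d | d dvd n. h (d, n div d)) summable_on {0<..}"
proof -
  let ?S = "SIGMA n:{0<..}. {d::nat. d dvd n}"
  let ?k = "\<lambda>n d. h (d, n div d)"
  have k: "(\<lambda>(n, d). ?k n d) summable_on ?S"
    using assms summable_on_reindex_bij_betw[OF bij_betw_divisor_pairs, of h]
    by (simp add: case_prod_unfold)
  have fin: "infsum (?k n) {d. d dvd n} = (\<Sum>d | d dvd n. ?k n d)" if "n \<in> {0<..}" for n
    using that by (intro infsum_finite) (auto intro: finite_divisors_nat)
  have "infsum h ({0<..} \<times> {0<..}) = infsum (\<lambda>(n, d). ?k n d) ?S"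
    using infsum_reindex_bij_betw[OF bij_betw_divisor_pairs, of h]
    by (simp add: case_prod_unfold)
  also have "\<dots> = (\<Sum>\<^sub>\<infinity>n\<in>{0<..}. infsum (?k n) {d. d dvd n})"
    by (rule infsum_Sigma'_banach[symmetric, OF k])
  also have "\<dots> = (\<Sum>\<^sub>\<infinity>n\<in>{0<..}. \<Sum>d | d dvd n. ?k n d)"
    by (rule infsum_cong) (rule fin)
  finally show "infsum h ({0<..} \<times> {0<..}) = (\<Sum>\<^sub>\<infinity>n\<in>{0<..}. \<Sum>d | d dvd n. h (d, n div d))" .
  show "(\<lambda>n. \<Sum>d | d dvd n. h (d, n div d)) summable_on {0<..}"
    by (rule summable_on_cong[THEN iffD1, OF fin summable_on_Sigma_banach[OF k]])
qed

text \<open>Double series are rearranged with \<open>infsum\<close>, whereas the series at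
  \<open>s = 1\<close> may converge only conditionally and need the ordered \<open>suminf\<close>;
  absolutely convergent series pass between the two.\<close>

lemma infsum_pos_eq_suminf:
  fixes f :: "nat \<Rightarrow> real"
  assumes "summable (\<lambda>n. \<bar>f n\<bar>)" "f 0 = 0"
  shows "infsum f {0<..} = suminf f" and "f abs_summable_on {0<..}"
proof -
  have hs: "(f has_sum suminf f) UNIV"
    using assms by (intro norm_summable_imp_has_sum summable_sums) (auto intro: summable_rabs_cancel)
  then have "(f has_sum suminf f) {0<..}"
    by (rule has_sum_cong_neutral[THEN iffD1, rotated -1]) (use assms in auto)
  then show "infsum f {0<..} = suminf f" by (rule infsumI)
  have "(\<lambda>n. norm (f n)) summable_on UNIV"
    using assms by (intro norm_summable_imp_summable_on) simp
  then show "f abs_summable_on {0<..}"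
    by (rule summable_on_subset_banach) simp
qed

text \<open>Multiplication of Dirichlet series, the powers of \<open>n\<close> being absorbed into
  \<open>f\<close> and \<open>g\<close>: absolute convergence allows the sum over
  \<open>(a, b)\<close> to be grouped by \<open>a * b\<close>.\<close>

lemma suminf_mult_divisor_sum:
  fixes f g :: "nat \<Rightarrow> real"
  assumes f: "summable (\<lambda>n. \<bar>f n\<bar>)" "f 0 = 0" and g: "summable (\<lambda>n. \<bar>g n\<bar>)" "g 0 = 0"
    and h: "\<And>n. n > 0 \<Longrightarrow> h n = (\<Sum>d | d dvd n. f d * g (n div d))" "h 0 = 0"
      "summable (\<lambda>n. \<bar>h n\<bar>)"
  shows "suminf f * suminf g = suminf h"
proof -
  let ?P = "{0<..} :: nat set"
  have fs: "(\<lambda>a. \<bar>f a\<bar>) summable_on ?P" and gs: "(\<lambda>b. \<bar>g b\<bar>) summable_on ?P"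
    using infsum_pos_eq_suminf(2)[OF f] infsum_pos_eq_suminf(2)[OF g] by simp_all
  have "(\<lambda>b. f a * g b) abs_summable_on ?P" for a
    unfolding real_norm_def abs_mult by (intro summable_on_cmult_right gs)
  moreover have "(\<lambda>a. \<bar>f a\<bar> * infsum (\<lambda>b. \<bar>g b\<bar>) ?P) abs_summable_on ?P"
    unfolding real_norm_def abs_mult abs_idempotent by (intro summable_on_cmult_left fs)
  ultimately have "(\<lambda>(a, b). f a * g b) abs_summable_on ?P \<times> ?P"
    by (subst abs_summable_on_Sigma_iff) (simp add: abs_mult infsum_cmult_right')
  then have s: "(\<lambda>(a, b). f a * g b) summable_on ?P \<times> ?P"
    by (rule abs_summable_summable)
  have "suminf f * suminf g = infsum f ?P * infsum g ?P"
    using infsum_pos_eq_suminf(1)[OF f] infsum_pos_eq_suminf(1)[OF g] by simp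
  also have "\<dots> = (\<Sum>\<^sub>\<infinity>a\<in>?P. \<Sum>\<^sub>\<infinity>b\<in>?P. f a * g b)"
    by (simp add: infsum_cmult_right' infsum_cmult_left')
  also have "\<dots> = infsum (\<lambda>(a, b). f a * g b) (?P \<times> ?P)"
    by (rule infsum_Sigma'_banach[OF s])
  also have "\<dots> = infsum h ?P"
    unfolding infsum_divisor_pairs(1)[OF s] by (rule infsum_cong) (simp add: h)
  also have "\<dots> = suminf h"
    by (rule infsum_pos_eq_suminf(1)) (use h in auto)
  finally show ?thesis .
qed

lemma bij_betw_prime_power_divisors:
  fixes p m k :: nat
  assumes p: "prime p" and m: "\<not> p dvd m"
  shows "bij_betw (\<lambda>(i, d). p ^ i * d) ({..k} \<times> {d. d dvd m}) {d. d dvd p ^ k * m}"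
  unfolding bij_betw_def
proof
  have p0: "p > 0" using prime_gt_0_nat[OF p] .
  have mult: "multiplicity p (p ^ i * d) = i" if "d dvd m" for i d
    using that m p p0 by (intro multiplicity_eqI) (auto dest: dvd_trans)
  show "inj_on (\<lambda>(i, d). p ^ i * d) ({..k} \<times> {d. d dvd m})"
  proof (rule inj_onI, clarsimp)
    fix i d j e assume d: "d dvd m" and e: "e dvd m" and eq: "p ^ i * d = p ^ j * e"
    then have "i = j" using mult[OF d, of i] mult[OF e, of j] by simp
    then show "i = j \<and> d = e" using eq p0 by simp
  qed
  show "(\<lambda>(i, d). p ^ i * d) ` ({..k} \<times> {d. d dvd m}) = {d. d dvd p ^ k * m}"
  proof (intro equalityI subsetI)
    fix x assume "x \<in> {d. d dvd p ^ k * m}"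
    then have "x dvd p ^ k * m" by simp
    then obtain a b where ab: "x = a * b" "a dvd p ^ k" "b dvd m"
      by (metis division_decomp)
    then obtain i where "i \<le> k" "a = p ^ i" using divides_primepow_nat[OF p] by blast
    then show "x \<in> (\<lambda>(i, d). p ^ i * d) ` ({..k} \<times> {d. d dvd m})" using ab by auto
  qed (auto intro!: mult_dvd_mono le_imp_power_dvd)
qed

text \<open>The local factor at a prime of a divisor sum. At \<open>x = -1\<close> the alternating
  sum is 1 for even \<open>k\<close> and 0 for odd \<open>k\<close>; at \<open>x = 0\<close> only
  \<open>0 ^ 0 = 1\<close> survives.\<close>

lemma sum_powers_sign_ge:
  fixes x :: real
  assumes "x \<in> {-1, 0, 1}"
  shows "(\<Sum>i\<le>k. x ^ i) \<ge> of_bool (even k)"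
proof -
  have "(\<Sum>i\<le>k. (-1::real) ^ i) = of_bool (even k)" by (induction k) auto
  moreover have "(\<Sum>i\<le>k. (0::real) ^ i) = 1" by (induction k) auto
  ultimately show ?thesis using assms by auto
qed

section \<open>Real characters and their series for \<open>s > 1\<close>\<close>

locale real_character =
  fixes N :: nat and chi :: "nat \<Rightarrow> real"
  assumes modulus: "N > 1"
    and mult: "chi (a * b) = chi a * chi b"
    and periodic: "chi (a + N) = chi a"
    and range: "chi a \<in> {-1, 0, 1}"
    and zero_iff: "chi a = 0 \<longleftrightarrow> \<not> coprime a N"
begin

lemma chi_0 [simp]: "chi 0 = 0"
  using zero_iff[of 0] modulus by simp

lemma chi_1 [simp]: "chi (Suc 0) = 1"
  using mult[of 1 1] zero_iff[of 1] by simp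

lemma chi_power: "chi (a ^ k) = chi a ^ k"
  by (induction k) (simp_all add: mult)

lemma abs_chi_le_1: "\<bar>chi a\<bar> \<le> 1"
  using range[of a] by auto

lemma chi_add_mult: "chi (a + k * N) = chi a"
proof (induction k)
  case (Suc k)
  have "chi (a + Suc k * N) = chi ((a + k * N) + N)" by (simp add: algebra_simps)
  then show ?case using Suc periodic by simp
qed simp

lemma chi_mod: "chi (a mod N) = chi a"
  using chi_add_mult[of "a mod N" "a div N"] by simp

text \<open>The divisor sum is multiplicative, and its local factors are nonnegative and at least 1
  for even exponents; a square has even exponents only. The induction splits off one prime with its
  full power. This positivity drives the proof that \<open>L 1\<close> is nonzero.\<close>

lemma divisor_sum_ge:
  assumes "n > 0"
  shows "(\<Sum>d | d dvd n. chi d) \<ge> of_bool (\<exists>r. n = r\<^sup>2)"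
  using assms
proof (induction n rule: less_induct)
  case (less n)
  show ?case
  proof (cases "n = 1")
    case True
    then have "{d. d dvd n} = {1}" by auto
    then show ?thesis by simp
  next
    case False
    then obtain p where p: "prime p" "p dvd n" using prime_factor_nat by blast
    define k where "k = multiplicity p n"
    have "\<not> is_unit p" "n \<noteq> 0" using p less.prems by auto
    then obtain y where y: "n = p ^ k * y" "\<not> p dvd y"
      unfolding k_def using multiplicity_decompose'[of n p] by blast
    have k0: "k > 0" using y p by (metis gr0I mult_1 power_0)
    have y0: "y > 0" using y less.prems by (cases "y = 0") auto
    have "p ^ k > 1" using k0 prime_gt_1_nat[OF p(1)] by (intro one_less_power)
    then have lt: "y < n" using y y0 by simp
    have "(\<Sum>d | d dvd n. chi d) = (\<Sum>(i, d)\<in>{..k} \<times> {d. d dvd y}. chi (p ^ i * d))"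
      unfolding y(1)
      using sum.reindex_bij_betw[OF bij_betw_prime_power_divisors[OF p(1) y(2)], of chi k]
      by (simp add: case_prod_unfold)
    also have "\<dots> = (\<Sum>i\<le>k. chi p ^ i) * (\<Sum>d | d dvd y. chi d)"
      by (simp add: sum_product sum.cartesian_product mult chi_power)
    also have "\<dots> \<ge> of_bool (even k) * of_bool (\<exists>r. y = r\<^sup>2)"
      using less.IH[OF lt y0] sum_powers_sign_ge[OF range, of k p]
      by (intro mult_mono) (auto intro: order_trans[OF zero_less_eq_of_bool])
    finally have ge: "(\<Sum>d | d dvd n. chi d) \<ge> of_bool (even k) * of_bool (\<exists>r. y = r\<^sup>2)" .
    have "even k \<and> (\<exists>r. y = r\<^sup>2)" if "n = r\<^sup>2" for r
    proof -
      have "r \<noteq> 0" using that less.prems by auto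
      then obtain z where z: "r = p ^ multiplicity p r * z" "\<not> p dvd z"
        using multiplicity_decompose'[of r p] \<open>\<not> is_unit p\<close> by blast
      have k2: "k = 2 * multiplicity p r"
        unfolding k_def that using p \<open>r \<noteq> 0\<close> by (subst prime_elem_multiplicity_power_distrib) auto
      have "p ^ k * y = p ^ k * z\<^sup>2"
        using z(1) y(1) that k2 by (metis power_mult_distrib power_mult mult.commute)
      then have "y = z\<^sup>2" using p by auto
      then show ?thesis using k2 by auto
    qed
    then show ?thesis using ge by (auto simp: of_bool_def split: if_splits)
  qed
qed

text \<open>An ordered sum, so that it has a meaning at \<open>s = 1\<close> for nonprincipal
  \<open>chi\<close>; the term at 0 vanishes because \<open>chi 0 = 0\<close>.\<close>

abbreviation L :: "real \<Rightarrow> real" where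
  "L s \<equiv> \<Sum>n. chi n * real n powr - s"

lemma summable_abs_ln:
  assumes "s > 1"
  shows "summable (\<lambda>n. ln (real n) * real n powr - s)"
proof (rule summable_comparison_test')
  \<comment> \<open>Half of the excess \<open>s - 1\<close> pays for the logarithm, the other half
    for convergence.\<close>
  define \<delta> where "\<delta> = (s - 1) / 2"
  have \<delta>: "\<delta> > 0" "\<delta> - s < -1" using assms by (auto simp: \<delta>_def field_simps)
  show "summable (\<lambda>n. real n powr (\<delta> - s) / \<delta>)"
    using \<delta> by (intro summable_divide) (simp add: summable_real_powr_iff)
  fix n :: nat assume "n \<ge> 1"
  then have "ln (real n) * real n powr - s \<le> (real n powr \<delta> / \<delta>) * real n powr - s"
    using \<delta> by (intro mult_right_mono ln_powr_bound) auto
  also have "\<dots> = real n powr (\<delta> - s) / \<delta>"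
    by (simp flip: powr_add)
  finally show "norm (ln (real n) * real n powr - s) \<le> real n powr (\<delta> - s) / \<delta>"
    using \<open>n \<ge> 1\<close> by simp
qed

lemma summable_abs_L:
  assumes "s > 1"
  shows "summable (\<lambda>n. \<bar>chi n * real n powr - s\<bar>)"
proof (rule summable_comparison_test')
  show "summable (\<lambda>n. real n powr - s)" using assms by (simp add: summable_real_powr_iff)
  show "norm \<bar>chi n * real n powr - s\<bar> \<le> real n powr - s" for n
    using abs_chi_le_1[of n] by (simp add: abs_mult mult_left_le_one_le)
qed

lemma ln_term_bound: "\<bar>c\<bar> \<le> 1 \<Longrightarrow> \<bar>c * ln (real n) * real n powr - s\<bar> \<le> ln (real n) * real n powr - s"
  by (cases "n = 0") (auto simp: abs_mult intro!: mult_right_mono mult_left_le_one_le)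

lemma summable_abs_L_ln:
  assumes "s > 1"
  shows "summable (\<lambda>n. \<bar>chi n * ln (real n) * real n powr - s\<bar>)"
  by (rule summable_comparison_test'[OF summable_abs_ln[OF assms]])
    (use ln_term_bound abs_chi_le_1 in auto)

lemma mangoldt_le_ln: "n > 0 \<Longrightarrow> mangoldt n \<le> ln (real n)"
  using mangoldt_sum[of n, where 'a = real]
    member_le_sum[of n "{d. d dvd n}" "mangoldt :: nat \<Rightarrow> real"] mangoldt_nonneg
  by (simp add: finite_divisors_nat)

lemma summable_abs_L_mangoldt:
  assumes "s > 1"
  shows "summable (\<lambda>n. \<bar>chi n * mangoldt n * real n powr - s\<bar>)"
proof (rule summable_comparison_test'[OF summable_abs_ln[OF assms]])
  fix n :: nat assume n: "n \<ge> 1"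
  have "\<bar>chi n\<bar> * mangoldt n * real n powr - s \<le> 1 * ln (real n) * real n powr - s"
    using abs_chi_le_1[of n] mangoldt_le_ln[of n] mangoldt_nonneg[of n] n
    by (intro mult_right_mono mult_mono) auto
  then show "norm \<bar>chi n * mangoldt n * real n powr - s\<bar> \<le> ln (real n) * real n powr - s"
    by (simp add: abs_mult)
qed

text \<open>The identity \<open>(- L' / L) * L = - L'\<close>, read off from the coefficients by
  \<open>mangoldt_sum\<close>, so that no series has to be differentiated.\<close>

lemma L_times_mangoldt:
  assumes "s > 1"
  shows "(\<Sum>n. chi n * mangoldt n * real n powr - s) * L s = (\<Sum>n. chi n * ln (real n) * real n powr - s)"
proof (rule suminf_mult_divisor_sum)
  fix n :: nat assume n: "n > 0"
  have eq: "chi d * mangoldt d * real d powr - s * (chi (n div d) * real (n div d) powr - s)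
      = mangoldt d * (chi n * real n powr - s)" if "d dvd n" for d
  proof -
    obtain e where e: "n = d * e" using \<open>d dvd n\<close> by (auto elim: dvdE)
    then have "d > 0" using n by simp
    then show ?thesis using e by (simp add: mult powr_mult)
  qed
  have "(\<Sum>d | d dvd n. chi d * mangoldt d * real d powr - s * (chi (n div d) * real (n div d) powr - s))
      = (\<Sum>d | d dvd n. mangoldt d) * (chi n * real n powr - s)"
    unfolding sum_distrib_right by (intro sum.cong refl eq) simp
  also have "(\<Sum>d | d dvd n. mangoldt d) = ln (real n)" using mangoldt_sum[of n, where 'a = real] n by simp
  finally show "chi n * ln (real n) * real n powr - s
      = (\<Sum>d | d dvd n. chi d * mangoldt d * real d powr - s * (chi (n div d) * real (n div d) powr - s))"
    by (simp add: mult_ac)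
qed (use assms in \<open>auto intro: summable_abs_L summable_abs_L_mangoldt summable_abs_L_ln\<close>)

end

section \<open>Monsky's weights and the Lambert series\<close>

lemma sum_powers_square_ge:
  fixes u :: real
  assumes "u > 0" "n > 0"
  shows "(\<Sum>i<n. (u\<^sup>2) ^ i) \<ge> real n * u ^ (n - 1)"
proof -
  \<comment> \<open>The exponents \<open>i\<close> and \<open>n - 1 - i\<close> are paired: the two
    terms have geometric mean \<open>u ^ (n - 1)\<close>.\<close>
  have "2 * (\<Sum>i<n. (u\<^sup>2) ^ i) = (\<Sum>i<n. (u\<^sup>2) ^ i) + (\<Sum>i<n. (u\<^sup>2) ^ (n - Suc i))"
    by (subst sum.nat_diff_reindex) simp
  also have "\<dots> = (\<Sum>i<n. (u\<^sup>2) ^ i + (u\<^sup>2) ^ (n - Suc i))"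
    by (simp add: sum.distrib)
  also have "\<dots> \<ge> (\<Sum>i<n. 2 * u ^ (n - 1))"
  proof (rule sum_mono)
    fix i assume "i \<in> {..<n}"
    then have "u ^ (n - 1) = u ^ i * u ^ (n - Suc i)" by (simp flip: power_add)
    moreover have "0 \<le> (u ^ i - u ^ (n - Suc i))\<^sup>2" by simp
    ultimately show "2 * u ^ (n - 1) \<le> (u\<^sup>2) ^ i + (u\<^sup>2) ^ (n - Suc i)"
      by (simp add: power2_diff flip: power_mult) (simp add: mult.commute[of 2] power_mult)
  qed
  finally show ?thesis by simp
qed

text \<open>
  The weights of Monsky's proof that \<open>L(1, \<chi>) \<noteq> 0\<close>. Their monotonicity comes down to
  \<open>S\<^sub>n S\<^sub>n\<^sub>+\<^sub>1 \<ge> n (n + 1) t\<^sup>n\<close> for \<open>S\<^sub>n = 1 + t + \<dots> + t\<^sup>n\<^sup>-\<^sup>1\<close>, which is AM-GM;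
  the substitution \<open>t = u\<^sup>2\<close> keeps the exponents integral.
\<close>

definition lambert_weight :: "real \<Rightarrow> nat \<Rightarrow> real" where
  "lambert_weight t n = 1 / (real n * (1 - t)) - t ^ n / (1 - t ^ n)"

lemma lambert_weight_decreasing:
  assumes u: "0 < u" "u < 1" and n: "n > 0"
  shows "lambert_weight (u\<^sup>2) (Suc n) \<le> lambert_weight (u\<^sup>2) n"
proof -
  define t where "t = u\<^sup>2"
  define S where "S n = (\<Sum>i<n. t ^ i)" for n
  have t: "0 < t" "t < 1" using u by (auto simp: t_def power_less_one_iff)
  have geo: "1 - t ^ k = (1 - t) * S k" for k
    unfolding S_def by (rule one_diff_power_eq)
  have S_Suc: "S (Suc k) = 1 + t * S k" for k
    unfolding S_def by (subst sum.lessThan_Suc_shift) (simp add: sum_distrib_left)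
  have S_pos: "S k > 0" if "k > 0" for k
    unfolding S_def using that t by (intro sum_pos) auto
  have w: "(1 - t) * lambert_weight t k = 1 / real k - t ^ k / S k" if "k > 0" for k
    unfolding lambert_weight_def geo right_diff_distrib[of "1 - t"] using t
    by (simp del: right_diff_distrib')
  have Sn: "S n > 0" "S (Suc n) > 0" using S_pos n by auto
  \<comment> \<open>AM-GM for \<open>n\<close> and \<open>n + 1\<close> yields the exponent
    \<open>2 * n - 1\<close> of \<open>u\<close>; since \<open>u < 1\<close>, this power dominates
    \<open>t ^ n = u ^ (2 * n)\<close>.\<close>
  have "real n * real (Suc n) * t ^ n \<le> real n * real (Suc n) * u ^ (2 * n - 1)"
    unfolding t_def power_mult[symmetric]
    by (intro mult_left_mono power_decreasing) (use u in auto)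
  also have "\<dots> = (real n * u ^ (n - 1)) * (real (Suc n) * u ^ (Suc n - 1))"
  proof -
    have "2 * n - 1 = (n - 1) + (Suc n - 1)" using n by simp
    then show ?thesis by (simp only: power_add mult_ac)
  qed
  also have "\<dots> \<le> S n * S (Suc n)"
    unfolding S_def t_def using u n by (intro mult_mono sum_powers_square_ge sum_nonneg) auto
  finally have "t ^ n / (S n * S (Suc n)) \<le> 1 / (real n * real (Suc n))"
    using Sn n by (simp add: divide_simps mult_ac)
  moreover have "t ^ n / S n - t ^ Suc n / S (Suc n) = t ^ n / (S n * S (Suc n))"
  proof -
    have "t ^ n / S n - t ^ Suc n / S (Suc n) = t ^ n * (S (Suc n) - t * S n) / (S n * S (Suc n))"
      using Sn by (simp add: field_simps)
    then show ?thesis by (simp add: S_Suc)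
  qed
  moreover have "1 / real n - 1 / real (Suc n) = 1 / (real n * real (Suc n))"
    using n by (simp add: field_simps)
  ultimately have "1 / real (Suc n) - t ^ Suc n / S (Suc n) \<le> 1 / real n - t ^ n / S n"
    by linarith
  then have "(1 - t) * lambert_weight t (Suc n) \<le> (1 - t) * lambert_weight t n"
    using w n by simp
  then show ?thesis using t by (simp add: t_def)
qed

lemma lambert_weight_tendsto:
  assumes "0 < t" "t < 1"
  shows "lambert_weight t \<longlonglongrightarrow> 0"
proof -
  have "(\<lambda>n. t ^ n) \<longlonglongrightarrow> 0" using assms by (intro LIMSEQ_realpow_zero) auto
  moreover have "(\<lambda>n. 1 / real n) \<longlonglongrightarrow> 0" by (rule lim_1_over_n)
  ultimately have "(\<lambda>n. 1 / real n * (1 / (1 - t)) - t ^ n / (1 - t ^ n)) \<longlonglongrightarrow> 0 * (1 / (1 - t)) - 0 / (1 - 0)"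
    using assms by (intro tendsto_intros) auto
  then show ?thesis by (simp add: lambert_weight_def[abs_def])
qed

text \<open>Expanding \<open>t ^ a / (1 - t ^ a)\<close> as a geometric series and grouping by
  \<open>n = a * b\<close> turns the Lambert series into a power series whose coefficients are the
  divisor sums of \<open>chi\<close>. These are nonnegative, and at least 1 at squares.\<close>

lemma (in real_character) lambert_series_ge:
  fixes t :: real
  assumes t: "0 < t" "t < 1"
  shows "summable (\<lambda>i. chi (Suc i) * (t ^ Suc i / (1 - t ^ Suc i)))"
    and "(\<Sum>m\<in>{1..K}. t ^ (m\<^sup>2)) \<le> (\<Sum>i. chi (Suc i) * (t ^ Suc i / (1 - t ^ Suc i)))"
proof -
  let ?P = "{0<..} :: nat set"
  let ?g = "\<lambda>n. if n = 0 then 0 else chi n * (t ^ n / (1 - t ^ n))"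
  have P1: "?P = {1..}" by auto
  have pow: "0 < t ^ n" "t ^ n \<le> t" if "n > 0" for n
    using t that power_decreasing[of 1 n t] by auto
  have pos: "\<bar>t ^ n / (1 - t ^ n)\<bar> = t ^ n / (1 - t ^ n)" if "n > 0" for n
    using pow[OF that] t by simp
  have geom: "((\<lambda>b. (t ^ a) ^ b) has_sum (t ^ a / (1 - t ^ a))) ?P" if "a > 0" for a
    unfolding P1 using pow[OF that] t by (intro has_sum_geometric_from_1) auto
  have inner: "((\<lambda>b. c * t ^ (a * b)) has_sum (c * (t ^ a / (1 - t ^ a)))) ?P" if "a > 0" for a c
    using has_sum_cmult_right[OF geom[OF that], of c] by (simp add: power_mult)
  have bound: "\<bar>chi n * (t ^ n / (1 - t ^ n))\<bar> \<le> t ^ n / (1 - t)" if "n > 0" for n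
  proof -
    have "\<bar>chi n\<bar> * \<bar>t ^ n / (1 - t ^ n)\<bar> \<le> 1 * (t ^ n / (1 - t))"
      using abs_chi_le_1[of n] pow[OF that] t by (intro mult_mono) (auto simp: frac_le)
    then show ?thesis by (simp add: abs_mult)
  qed
  have gs: "summable (\<lambda>n. \<bar>?g n\<bar>)"
  proof (rule summable_comparison_test')
    show "summable (\<lambda>n. t ^ n / (1 - t))" using t by (intro summable_divide summable_geometric) auto
    show "norm \<bar>?g n\<bar> \<le> t ^ n / (1 - t)" for n using bound t by auto
  qed
  then have "summable ?g" by (rule summable_rabs_cancel)
  then show s: "summable (\<lambda>i. chi (Suc i) * (t ^ Suc i / (1 - t ^ Suc i)))"
    by (subst (asm) summable_Suc_iff[symmetric]) simp
  have G: "(\<Sum>i. chi (Suc i) * (t ^ Suc i / (1 - t ^ Suc i))) = infsum ?g ?P"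
    using infsum_pos_eq_suminf(1)[OF gs] suminf_split_head[OF \<open>summable ?g\<close>] by simp
  have outer: "(\<lambda>a. \<bar>chi a\<bar> * (t ^ a / (1 - t ^ a))) summable_on ?P"
  proof -
    have "(\<lambda>n. \<bar>?g n\<bar>) summable_on ?P" using infsum_pos_eq_suminf(2)[OF gs] by simp
    then show ?thesis
      by (rule summable_on_cong[THEN iffD1, rotated]) (simp add: abs_mult pos del: abs_divide times_divide_eq_right)
  qed
  let ?h = "\<lambda>(a, b). chi a * t ^ (a * b)"
  have nh: "norm (?h (a, b)) = \<bar>chi a\<bar> * t ^ (a * b)" for a b
    using t by (simp add: abs_mult)
  have "?h abs_summable_on ?P \<times> ?P"
  proof (subst abs_summable_on_Sigma_iff, intro conjI ballI)
    show "(\<lambda>b. ?h (a, b)) abs_summable_on ?P" if "a \<in> ?P" for a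
      unfolding nh using inner[of a "\<bar>chi a\<bar>"] that by (auto simp: summable_on_def)
    have "infsum (\<lambda>b. norm (?h (a, b))) ?P = \<bar>chi a\<bar> * (t ^ a / (1 - t ^ a))" if "a \<in> ?P" for a
      unfolding nh using inner[of a "\<bar>chi a\<bar>"] that by (intro infsumI) auto
    moreover have "(\<lambda>a. \<bar>chi a\<bar> * (t ^ a / (1 - t ^ a))) abs_summable_on ?P"
      by (rule summable_on_iff_abs_summable_on_real[THEN iffD1, OF outer])
    ultimately show "(\<lambda>a. infsum (\<lambda>b. norm (?h (a, b))) ?P) abs_summable_on ?P"
      by (subst summable_on_cong) auto
  qed
  then have hs: "?h summable_on ?P \<times> ?P" by (rule abs_summable_summable)
  let ?A = "\<lambda>n. (\<Sum>d | d dvd n. ?h (d, n div d))"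
  have A: "?A n = (\<Sum>d | d dvd n. chi d) * t ^ n" for n
    by (auto simp: sum_distrib_right intro!: sum.cong)
  have "infsum ?g ?P = (\<Sum>\<^sub>\<infinity>a\<in>?P. \<Sum>\<^sub>\<infinity>b\<in>?P. ?h (a, b))"
  proof (rule infsum_cong)
    fix a assume "a \<in> ?P"
    then show "?g a = (\<Sum>\<^sub>\<infinity>b\<in>?P. ?h (a, b))"
      using infsumI[OF inner[of a "chi a"]] by simp
  qed
  also have "\<dots> = infsum ?A ?P"
    using infsum_Sigma_banach[OF hs] infsum_divisor_pairs(1)[OF hs] by simp
  also have "\<dots> \<ge> sum ?A ((\<lambda>m. m\<^sup>2) ` {1..K})"
  proof (rule finite_sum_le_infsum)
    show "?A summable_on ?P" by (rule infsum_divisor_pairs(2)[OF hs])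
    show "?A n \<ge> 0" if "n \<in> ?P - (\<lambda>m. m\<^sup>2) ` {1..K}" for n
      unfolding A using divisor_sum_ge[of n] that t
      by (intro mult_nonneg_nonneg order_trans[OF zero_less_eq_of_bool divisor_sum_ge]) auto
  qed auto
  also have "sum ?A ((\<lambda>m. m\<^sup>2) ` {1..K}) = (\<Sum>m\<in>{1..K}. ?A (m\<^sup>2))"
    by (subst sum.reindex) (auto simp: inj_on_def)
  also have "\<dots> \<ge> (\<Sum>m\<in>{1..K}. t ^ (m\<^sup>2))"
  proof (rule sum_mono)
    fix m assume "m \<in> {1..K}"
    then have "(\<Sum>d | d dvd m\<^sup>2. chi d) \<ge> 1" using divisor_sum_ge[of "m\<^sup>2"] by auto
    then have "1 * t ^ (m\<^sup>2) \<le> (\<Sum>d | d dvd m\<^sup>2. chi d) * t ^ (m\<^sup>2)"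
      using t by (intro mult_right_mono) auto
    then show "t ^ (m\<^sup>2) \<le> ?A (m\<^sup>2)" unfolding A by simp
  qed
  finally show "(\<Sum>m\<in>{1..K}. t ^ (m\<^sup>2)) \<le> (\<Sum>i. chi (Suc i) * (t ^ Suc i / (1 - t ^ Suc i)))"
    unfolding G by simp
qed

section \<open>Nonprincipal characters near \<open>s = 1\<close>\<close>

locale nonprincipal_character = real_character +
  assumes nonprincipal: "\<exists>a. chi a = -1"
begin

text \<open>Multiplication by \<open>a\<close> with \<open>chi a = -1\<close> permutes the residues
  and negates the sum.\<close>

lemma sum_period: "(\<Sum>i<N. chi i) = 0"
proof -
  obtain a where a: "chi a = -1" using nonprincipal by blast
  then have cop: "coprime a N" using zero_iff[of a] by auto
  have inj: "inj_on (\<lambda>i. a * i mod N) {..<N}"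
  proof (rule inj_onI)
    fix i j assume ij: "i \<in> {..<N}" "j \<in> {..<N}" "a * i mod N = a * j mod N"
    have "[a * i = a * j] (mod N)" unfolding unique_euclidean_semiring_class.cong_def by (rule ij(3))
    then have "[i = j] (mod N)" using cong_mult_lcancel_nat[OF cop] by simp
    then show "i = j" using cong_less_modulus_unique_nat ij by simp
  qed
  have "(\<lambda>i. a * i mod N) ` {..<N} = {..<N}"
    using modulus inj by (intro endo_inj_surj) auto
  then have "(\<Sum>i<N. chi i) = (\<Sum>i<N. chi (a * i mod N))"
    using sum.reindex[OF inj, of chi] by simp
  also have "\<dots> = - (\<Sum>i<N. chi i)" by (simp add: chi_mod mult a sum_negf)
  finally show ?thesis by simp
qed

lemma partial_sum_bound: "\<bar>\<Sum>i<k. chi i\<bar> \<le> real N"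
proof -
  have step: "(\<Sum>i<n + N. chi i) = (\<Sum>i<n. chi i)" for n
    by (induction n) (simp_all add: sum_period periodic)
  have "(\<Sum>i<n + q * N. chi i) = (\<Sum>i<n. chi i)" for n q
  proof (induction q)
    case (Suc q)
    then show ?case using step[of "n + q * N"] by (simp add: algebra_simps)
  qed simp
  from this[of "k mod N" "k div N"] have "(\<Sum>i<k. chi i) = (\<Sum>i<k mod N. chi i)" by simp
  also have "\<bar>\<dots>\<bar> \<le> (\<Sum>i<k mod N. 1)"
    by (rule order_trans[OF sum_abs sum_mono]) (rule abs_chi_le_1)
  also have "\<dots> \<le> real N" using modulus by simp
  finally show ?thesis .
qed

lemma dirichlet_tail:
  assumes "decseq b" "b \<longlonglongrightarrow> 0"
  shows "summable (\<lambda>i. chi (i + m) * b i)" and "\<bar>\<Sum>i. chi (i + m) * b i\<bar> \<le> 2 * real N * b 0"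
  using dirichlet_test[OF partial_sum_shift_bound[OF partial_sum_bound] assms] by blast+

lemma L_tail:
  assumes "s \<ge> 1" "m > 0"
  shows "summable (\<lambda>i. chi (i + m) * real (i + m) powr - s)"
    and "\<bar>\<Sum>i. chi (i + m) * real (i + m) powr - s\<bar> \<le> 2 * real N / real m"
proof -
  let ?b = "\<lambda>i. real (i + m) powr - s"
  have dec: "decseq ?b"
    using assms by (intro decseq_SucI powr_mono2') auto
  have "filterlim (\<lambda>i. real (i + m)) at_top sequentially"
    by (intro filterlim_compose[OF filterlim_real_sequentially] filterlim_add_const_nat_at_top)
  then have lim: "?b \<longlonglongrightarrow> 0"
    using assms by (intro tendsto_neg_powr) auto
  show "summable (\<lambda>i. chi (i + m) * real (i + m) powr - s)"
    using dirichlet_tail(1)[OF dec lim] .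
  have "real m powr - s \<le> real m powr - 1" using assms by (intro powr_mono) auto
  then have "real m powr - s \<le> 1 / real m" using assms by (simp add: powr_minus_divide)
  then have "2 * real N * real m powr - s \<le> 2 * real N * (1 / real m)"
    by (intro mult_left_mono) auto
  then show "\<bar>\<Sum>i. chi (i + m) * real (i + m) powr - s\<bar> \<le> 2 * real N / real m"
    using dirichlet_tail(2)[OF dec lim, of m] by simp
qed

lemma summable_L: "s \<ge> 1 \<Longrightarrow> summable (\<lambda>n. chi n * real n powr - s)"
  using L_tail(1)[of s 1] summable_iff_shift[of "\<lambda>n. chi n * real n powr - s" 1] by simp

text \<open>Beyond \<open>m\<close> the series is at most \<open>2 N / m\<close> in absolute value
  for all \<open>s \<ge> 1\<close> alike, and the head is a finite sum continuous in
  \<open>s\<close>.\<close>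

lemma L_tendsto: "(L \<longlongrightarrow> L 1) (at_right 1)"
proof (rule tendstoI)
  fix e :: real assume e: "e > 0"
  obtain m where m: "m > 0" "2 * real N / real m < e / 3"
  proof -
    obtain m where "6 * real N / e < real m" using reals_Archimedean2 by blast
    moreover from this have "real m > 0" using e modulus by (smt (verit) divide_nonneg_pos of_nat_0_le_iff)
    ultimately show ?thesis using that[of m] e by (simp add: field_simps)
  qed
  let ?S = "\<lambda>s. \<Sum>i<m. chi i * real i powr - s"
  have "((\<lambda>s. chi i * real i powr - s) \<longlongrightarrow> chi i * real i powr - 1) (at_right 1)" for i
  proof (cases "i = 0")
    case False
    then show ?thesis by (intro tendsto_intros) auto
  qed simp
  then have "(?S \<longlongrightarrow> ?S 1) (at_right 1)" by (rule tendsto_sum)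
  then have "\<forall>\<^sub>F s in at_right 1. dist (?S s) (?S 1) < e / 3" using e by (intro tendstoD) auto
  moreover have "\<forall>\<^sub>F s in at_right (1::real). s > 1" by (simp add: eventually_at_right_less)
  ultimately show "\<forall>\<^sub>F s in at_right 1. dist (L s) (L 1) < e"
  proof eventually_elim
    case (elim s)
    define T where "T s = (\<Sum>i. chi (i + m) * real (i + m) powr - s)" for s
    have split: "L s = T s + ?S s" if "s \<ge> 1" for s
      unfolding T_def using summable_L[OF that] by (rule suminf_split_initial_segment)
    have T: "\<bar>T s\<bar> < e / 3" if "s \<ge> 1" for s
      using L_tail(2)[OF that m(1)] m(2) unfolding T_def by (rule le_less_trans)
    have "dist (L s) (L 1) = \<bar>T s - T 1 + (?S s - ?S 1)\<bar>"
    proof -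
      have "L s = T s + ?S s" by (rule split) (use elim in simp)
      moreover have "L 1 = T 1 + ?S 1" by (rule split) simp
      ultimately show ?thesis unfolding dist_real_def by linarith
    qed
    also have "\<dots> \<le> \<bar>T s\<bar> + \<bar>T 1\<bar> + dist (?S s) (?S 1)"
      unfolding dist_real_def by linarith
    also have "\<dots> < e" using T[of s] T[of 1] elim by linarith
    finally show ?case .
  qed
qed

text \<open>If \<open>L 1\<close> were 0, the part \<open>1 / (n (1 - t))\<close> of the weights
  would contribute nothing to their sum against \<open>chi\<close>, leaving minus the Lambert
  series. The Dirichlet test bounds this by \<open>2 N\<close> for all \<open>t\<close>, while the
  lower bound from squares outgrows \<open>2 N\<close> as \<open>t\<close> tends to 1.\<close>

lemma L_1_nonzero: "L 1 \<noteq> 0"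
proof
  assume L: "L 1 = 0"
  have sH: "summable (\<lambda>i. chi (Suc i) / real (Suc i))"
    using L_tail(1)[of 1 1] by (simp add: powr_minus_divide)
  have "(\<Sum>i. chi (Suc i) / real (Suc i)) = 0"
    using L suminf_split_head[OF summable_L[of 1]] by (simp add: powr_minus_divide)
  note H = sH this
  \<comment> \<open>One square more than the bound \<open>2 N\<close> permits: each of the
    \<open>K\<close> terms tends to 1.\<close>
  define K where "K = 2 * N + 1"
  have bound: "(\<Sum>m\<in>{1..K}. (u\<^sup>2) ^ (m\<^sup>2)) \<le> 2 * real N" if u: "0 < u" "u < 1" for u :: real
  proof -
    define t where "t = u\<^sup>2"
    have t: "0 < t" "t < 1" using u by (auto simp: t_def power_less_one_iff)
    let ?w = "\<lambda>i. lambert_weight t (Suc i)"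
    let ?g = "\<lambda>i. chi (Suc i) * (t ^ Suc i / (1 - t ^ Suc i))"
    have dec: "decseq ?w"
      unfolding t_def using lambert_weight_decreasing[OF u] by (intro decseq_SucI) auto
    have lim: "?w \<longlonglongrightarrow> 0"
      using lambert_weight_tendsto[OF t] by (rule LIMSEQ_Suc)
    \<comment> \<open>The first weight is \<open>1 / (1 - t) - t / (1 - t)\<close>, which makes the
      bound independent of \<open>t\<close>.\<close>
    have w0: "?w 0 = 1"
      using t by (simp add: lambert_weight_def flip: diff_divide_distrib)
    have "(\<lambda>i. chi (i + 1) * ?w i) = (\<lambda>i. chi (Suc i) / real (Suc i) * (1 / (1 - t)) - ?g i)"
      by (auto simp: lambert_weight_def right_diff_distrib)
    then have "(\<Sum>i. chi (i + 1) * ?w i) = (\<Sum>i. chi (Suc i) / real (Suc i) * (1 / (1 - t))) - suminf ?g"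
      using suminf_diff[OF summable_mult2[OF H(1), of "1 / (1 - t)"] lambert_series_ge(1)[OF t]] by simp
    also have "(\<Sum>i. chi (Suc i) / real (Suc i) * (1 / (1 - t))) = 0"
      using suminf_mult2[OF H(1), of "1 / (1 - t)"] H(2) by simp
    finally have "\<bar>suminf ?g\<bar> \<le> 2 * real N"
      using dirichlet_tail(2)[OF dec lim, of 1] w0 by simp
    then show ?thesis
      using lambert_series_ge(2)[OF t, of K] unfolding t_def by linarith
  qed
  have "((\<lambda>u::real. \<Sum>m\<in>{1..K}. (u\<^sup>2) ^ (m\<^sup>2)) \<longlongrightarrow> (\<Sum>m\<in>{1..K}. (1\<^sup>2) ^ (m\<^sup>2))) (at_left 1)"
    by (intro tendsto_intros)
  moreover have "\<forall>\<^sub>F u in at_left 1. (\<Sum>m\<in>{1..K}. (u\<^sup>2) ^ (m\<^sup>2)) \<le> 2 * real N"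
    using eventually_at_left_real[OF zero_less_one] by (rule eventually_mono) (use bound in auto)
  ultimately have "(\<Sum>m\<in>{1..K}. ((1::real)\<^sup>2) ^ (m\<^sup>2)) \<le> 2 * real N"
    by (rule tendsto_upperbound) simp
  then show False by (simp add: K_def)
qed

lemma L_ln_bounded:
  obtains C where "\<And>s. s > 1 \<Longrightarrow> \<bar>\<Sum>n. chi n * ln (real n) * real n powr - s\<bar> \<le> C"
proof
  fix s :: real assume s: "s > 1"
  \<comment> \<open>The tail starts at 3 because \<open>ln x / x\<close> decreases only from
    \<open>exp 1\<close> on; the remaining factor, with exponent \<open>1 - s\<close>, decreases as
    well.\<close>
  let ?b = "\<lambda>i. ln (real (i + 3)) * real (i + 3) powr - s"
  have b: "?b i = ln (real (i + 3)) / real (i + 3) * real (i + 3) powr (1 - s)" for i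
    by (simp add: powr_diff powr_minus_divide)
  have dec: "decseq ?b"
  proof (rule decseq_SucI)
    fix i
    have "exp 1 \<le> real (i + 3)" using exp_le by linarith
    then have "ln (real (Suc i + 3)) / real (Suc i + 3) \<le> ln (real (i + 3)) / real (i + 3)"
      by (rule ln_x_over_x_mono) simp
    moreover have "real (Suc i + 3) powr (1 - s) \<le> real (i + 3) powr (1 - s)"
      using s by (intro powr_mono2') auto
    ultimately show "?b (Suc i) \<le> ?b i"
      unfolding b by (intro mult_mono) auto
  qed
  have lim: "?b \<longlonglongrightarrow> 0"
  proof (rule tendsto_sandwich[where f = "\<lambda>_. 0" and h = "\<lambda>i. ln (real (i + 3)) / real (i + 3)"])
    show "\<forall>\<^sub>F i in sequentially. ?b i \<le> ln (real (i + 3)) / real (i + 3)"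
    proof (rule always_eventually, rule allI)
      fix i
      have "real (i + 3) powr (1 - s) \<le> 1" using s powr_mono[of "1 - s" 0 "real (i + 3)"] by simp
      then show "?b i \<le> ln (real (i + 3)) / real (i + 3)"
        unfolding b by (intro mult_right_le_one_le) auto
    qed
    show "(\<lambda>i. ln (real (i + 3)) / real (i + 3)) \<longlonglongrightarrow> 0" by real_asymp
  qed auto
  have tail: "\<bar>\<Sum>i. chi (i + 3) * ?b i\<bar> \<le> 2 * real N * ln 3"
  proof -
    have "?b 0 \<le> ln 3"
      using s powr_mono[of "- s" 0 3] by (simp add: mult_right_le_one_le)
    then have "2 * real N * ?b 0 \<le> 2 * real N * ln 3" by (intro mult_left_mono) auto
    then show ?thesis using dirichlet_tail(2)[OF dec lim, of 3] by linarith
  qed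
  let ?f = "\<lambda>n. chi n * ln (real n) * real n powr - s"
  have "summable ?f" by (rule summable_rabs_cancel[OF summable_abs_L_ln[OF s]])
  then have split: "suminf ?f = (\<Sum>i. ?f (i + 3)) + (\<Sum>i<3. ?f i)"
    by (rule suminf_split_initial_segment)
  have "\<bar>\<Sum>i<3. ?f i\<bar> \<le> (\<Sum>i<3. \<bar>ln (real i)\<bar>)"
  proof (rule order_trans[OF sum_abs sum_mono])
    fix i :: nat
    show "\<bar>?f i\<bar> \<le> \<bar>ln (real i)\<bar>"
    proof (cases "i = 0")
      case False
      then have "real i powr - s \<le> 1" using s powr_mono[of "- s" 0 "real i"] by simp
      then have "\<bar>chi i\<bar> * \<bar>ln (real i)\<bar> * real i powr - s \<le> 1 * \<bar>ln (real i)\<bar> * 1"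
        using abs_chi_le_1[of i] by (intro mult_mono) auto
      then show ?thesis by (simp add: abs_mult)
    qed simp
  qed
  with tail split show "\<bar>suminf ?f\<bar> \<le> 2 * real N * ln 3 + (\<Sum>i<3. \<bar>ln (real i)\<bar>)"
    by (simp add: mult.assoc)
qed

text \<open>Near 1 the factor \<open>L s\<close> stays away from 0, so
  \<open>L_times_mangoldt\<close> can be divided by it.\<close>

lemma mangoldt_series_bounded:
  obtains C where "\<forall>\<^sub>F s in at_right 1. \<bar>\<Sum>n. chi n * mangoldt n * real n powr - s\<bar> \<le> C"
proof -
  obtain C where C: "\<And>s. s > 1 \<Longrightarrow> \<bar>\<Sum>n. chi n * ln (real n) * real n powr - s\<bar> \<le> C"
    using L_ln_bounded by blast
  define c where "c = \<bar>L 1\<bar> / 2"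
  have c: "c > 0" using L_1_nonzero by (simp add: c_def)
  have "((\<lambda>s. \<bar>L s\<bar>) \<longlongrightarrow> \<bar>L 1\<bar>) (at_right 1)" by (rule tendsto_rabs[OF L_tendsto])
  then have "\<forall>\<^sub>F s in at_right 1. \<bar>L s\<bar> > c"
    by (rule order_tendstoD) (use c in \<open>simp add: c_def\<close>)
  moreover have "\<forall>\<^sub>F s in at_right (1::real). s > 1" by (simp add: eventually_at_right_less)
  ultimately have "\<forall>\<^sub>F s in at_right 1. \<bar>\<Sum>n. chi n * mangoldt n * real n powr - s\<bar> \<le> C / c"
  proof eventually_elim
    case (elim s)
    let ?F = "\<Sum>n. chi n * mangoldt n * real n powr - s"
    have "\<bar>?F\<bar> * c \<le> \<bar>?F\<bar> * \<bar>L s\<bar>" using elim by (intro mult_left_mono) auto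
    also have "\<dots> \<le> C" using C L_times_mangoldt elim by (simp flip: abs_mult)
    finally show ?case using c by (simp add: pos_le_divide_eq)
  qed
  then show ?thesis by (rule that)
qed

end

section \<open>The principal character near \<open>s = 1\<close>\<close>

context real_character
begin

text \<open>The numbers \<open>1 + j * N\<close> have character value 1, and their reciprocals
  already form a divergent series; finitely many of the terms are continuous in
  \<open>s\<close>.\<close>

lemma L_principal_at_top:
  assumes principal: "\<And>a. chi a \<ge> 0"
  shows "filterlim L at_top (at_right 1)"
  unfolding filterlim_at_top
proof
  fix Z :: real
  let ?f = "\<lambda>j. 1 / (real j * real N + 1)"
  have "\<not> summable ?f"
  proof
    assume "summable ?f"
    then have "summable (\<lambda>j. real N * ?f j)" by (rule summable_mult)
    then have "summable (\<lambda>j. inverse (real (Suc j)))"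
    proof (rule summable_comparison_test')
      fix j :: nat
      have "real j * real N + 1 \<le> real N * real (Suc j)"
        using modulus by (simp add: algebra_simps)
      moreover have "real j * real N + 1 > 0" using modulus by (simp add: add_nonneg_pos)
      ultimately have "1 / real (Suc j) \<le> real N * ?f j"
        by (simp add: field_simps)
      then show "norm (inverse (real (Suc j))) \<le> real N * ?f j"
        by (simp add: inverse_eq_divide)
    qed
    then show False
      using not_summable_harmonic[where 'a = real] by (subst (asm) summable_Suc_iff) simp
  qed
  then obtain J where J: "(\<Sum>j<J. ?f j) > Z"
    using summableI_nonneg_bounded[of ?f Z] by (meson add_nonneg_nonneg divide_nonneg_nonneg
      mult_nonneg_nonneg not_le of_nat_0_le_iff zero_le_one)
  have "((\<lambda>s. \<Sum>j<J. (real j * real N + 1) powr - s) \<longlongrightarrow> (\<Sum>j<J. (real j * real N + 1) powr - 1)) (at_right 1)"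
    by (intro tendsto_intros) (auto simp: add_nonneg_eq_0_iff)
  moreover have "(\<Sum>j<J. (real j * real N + 1) powr - 1) = (\<Sum>j<J. ?f j)"
    by (intro sum.cong refl) (simp add: powr_minus_divide add_nonneg_pos)
  ultimately have "\<forall>\<^sub>F s in at_right 1. (\<Sum>j<J. (real j * real N + 1) powr - s) > Z"
    using J by (intro order_tendstoD(1)) auto
  moreover have "\<forall>\<^sub>F s in at_right (1::real). s > 1" by (simp add: eventually_at_right_less)
  ultimately show "\<forall>\<^sub>F s in at_right 1. Z \<le> L s"
  proof eventually_elim
    case (elim s)
    have inj: "inj_on (\<lambda>j. 1 + j * N) {..<J}" using modulus by (auto simp: inj_on_def)
    have "(\<Sum>j<J. (real j * real N + 1) powr - s)
        = (\<Sum>n\<in>(\<lambda>j. 1 + j * N) ` {..<J}. chi n * real n powr - s)"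
      by (subst sum.reindex[OF inj], intro sum.cong refl) (use chi_add_mult[of 1] in \<open>simp add: add.commute\<close>)
    also have "\<dots> \<le> L s"
      using principal summable_abs_L[OF elim(2)]
      by (intro sum_le_suminf) (auto intro: summable_rabs_cancel)
    finally show ?case using elim by linarith
  qed
qed

text \<open>Divergence of \<open>L\<close> at any rate suffices. Every \<open>n \<ge> K\<close>
  weighs at least \<open>ln K\<close> in the logarithmic series, which is therefore at least
  \<open>ln K * L s - K * ln K\<close>. Dividing by \<open>L s\<close>, once this exceeds
  \<open>K * ln K\<close>, leaves at least \<open>ln K - 1\<close>.\<close>

lemma mangoldt_series_principal_at_top:
  assumes principal: "\<And>a. chi a \<ge> 0"
  shows "\<forall>\<^sub>F s in at_right 1. (\<Sum>n. chi n * mangoldt n * real n powr - s) \<ge> B"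
proof -
  obtain K :: nat where K: "real K \<ge> exp (\<bar>B\<bar> + 1)" using real_arch_simple by blast
  have K0: "real K > 0" using K exp_gt_zero by (rule less_le_trans[rotated])
  have lnK: "ln (real K) \<ge> \<bar>B\<bar> + 1" using K K0 by (simp add: ln_ge_iff)
  have "\<forall>\<^sub>F s in at_right 1. L s \<ge> real K * ln (real K) + 1"
    using L_principal_at_top[OF principal] unfolding filterlim_at_top by blast
  moreover have "\<forall>\<^sub>F s in at_right (1::real). s > 1" by (simp add: eventually_at_right_less)
  ultimately show ?thesis
  proof eventually_elim
    case (elim s)
    note sL = summable_rabs_cancel[OF summable_abs_L[OF elim(2)]]
      and sD = summable_rabs_cancel[OF summable_abs_L_ln[OF elim(2)]]
    let ?D = "\<Sum>n. chi n * ln (real n) * real n powr - s"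
    let ?F = "\<Sum>n. chi n * mangoldt n * real n powr - s"
    \<comment> \<open>Pays for the terms with \<open>n < K\<close>, where \<open>ln n\<close> is
      below \<open>ln K\<close>.\<close>
    let ?r = "\<lambda>n. if n \<in> {..<K} then ln (real K) else 0"
    have r: "?r sums (real K * ln (real K))"
      using sums_If_finite_set[of "{..<K}" "\<lambda>_. ln (real K)"] by simp
    have "ln (real K) * L s = (\<Sum>n. ln (real K) * (chi n * real n powr - s))"
      by (rule suminf_mult[OF sL, symmetric])
    also have "\<dots> \<le> (\<Sum>n. chi n * ln (real n) * real n powr - s + ?r n)"
    proof (rule suminf_le)
      fix n
      have c: "0 \<le> chi n" "chi n \<le> 1" using principal abs_chi_le_1[of n] by auto
      have p: "real n powr - s \<le> 1" if "n > 0"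
        using elim(2) that powr_mono[of "- s" 0 "real n"] by simp
      show "ln (real K) * (chi n * real n powr - s) \<le> chi n * ln (real n) * real n powr - s + ?r n"
      proof (cases "n < K")
        case True
        have "ln (real K) * (chi n * real n powr - s) \<le> ln (real K) * (1 * 1)"
        proof (cases "n = 0")
          case False
          then show ?thesis using p c lnK by (intro mult_left_mono mult_mono) auto
        qed (use lnK in auto)
        moreover have "chi n * ln (real n) * real n powr - s \<ge> 0"
          using c by (cases "n = 0") auto
        ultimately show ?thesis using True by simp
      next
        case False
        then have "ln (real K) \<le> ln (real n)" using K0 by simp
        then have "ln (real K) * (chi n * real n powr - s) \<le> ln (real n) * (chi n * real n powr - s)"
          using c by (intro mult_right_mono) auto
        then show ?thesis using False by (simp add: mult_ac)
      qed
    next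
      show "summable (\<lambda>n. ln (real K) * (chi n * real n powr - s))" using sL by (rule summable_mult)
      show "summable (\<lambda>n. chi n * ln (real n) * real n powr - s + ?r n)"
        using sD sums_summable[OF r] by (rule summable_add)
    qed
    also have "\<dots> = ?D + real K * ln (real K)"
      using suminf_add[OF sD sums_summable[OF r]] sums_unique[OF r] by simp
    also have "?D = ?F * L s" using L_times_mangoldt[OF elim(2)] by simp
    finally have le: "ln (real K) * L s \<le> ?F * L s + real K * ln (real K)" .
    have Kln: "real K * ln (real K) \<ge> 0" using K0 lnK by (intro mult_nonneg_nonneg) auto
    have "(ln (real K) - 1) * L s \<le> ?F * L s"
      using le elim(1) by (simp add: algebra_simps)
    then have "ln (real K) - 1 \<le> ?F"
      using elim(1) Kln by (simp add: mult_le_cancel_right)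
    then show ?case using lnK by linarith
  qed
qed

end

section \<open>Primes with prescribed character values\<close>

lemma prod_signs:
  fixes f :: "'i \<Rightarrow> real"
  assumes "finite S" "\<And>i. i \<in> S \<Longrightarrow> f i \<in> {-1, 1}"
  shows "prod f S \<in> {-1, 1}"
  using assms
proof (induction S)
  case (insert i S)
  then have "f i \<in> {-1, 1}" "prod f S \<in> {-1, 1}" by blast+
  then show ?case using insert.hyps by auto
qed simp

lemma sum_Pow_prod_signs:
  fixes f :: "'i \<Rightarrow> real"
  assumes "finite I"
  shows "(\<Sum>S\<in>Pow I. \<Prod>i\<in>S. f i) = (\<Prod>i\<in>I. 1 + f i)"
  using prod_add[OF assms, of f "\<lambda>_. 1"] by (simp add: add.commute)

text \<open>
  If no prime had the
  prescribed signs \<open>\<epsilon>\<^sub>i\<close>, then \<open>\<Prod>\<^sub>i (1 + \<epsilon>\<^sub>i \<psi>\<^sub>i(n))\<close> would vanish at all prime powers \<open>n\<close>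
  coprime to \<open>N\<close>; for even powers this uses that some \<open>\<epsilon>\<^sub>i\<close> is \<open>-1\<close>. Expanding the product
  gives a linear relation between the series \<open>\<Sum> \<chi>(n) \<Lambda>(n) n\<^sup>-\<^sup>s\<close>, of which only the principal
  one is unbounded as \<open>s\<close> tends to 1. The elements \<open>a\<^sub>i\<close> form a dual basis to the characters
  and witness that a nonempty product of them is nonprincipal.
\<close>

theorem prime_with_prescribed_signs:
  fixes N :: nat and I :: "'i set" and \<psi> :: "'i \<Rightarrow> nat \<Rightarrow> real" and \<epsilon> :: "'i \<Rightarrow> real" and a :: "'i \<Rightarrow> nat"
  assumes N: "N > 1" and I: "finite I"
    and mult: "\<And>i x y. i \<in> I \<Longrightarrow> coprime x N \<Longrightarrow> coprime y N \<Longrightarrow> \<psi> i (x * y) = \<psi> i x * \<psi> i y"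
    and periodic: "\<And>i x. i \<in> I \<Longrightarrow> coprime x N \<Longrightarrow> \<psi> i (x + N) = \<psi> i x"
    and range: "\<And>i x. i \<in> I \<Longrightarrow> coprime x N \<Longrightarrow> \<psi> i x \<in> {-1, 1}"
    and a: "\<And>i. i \<in> I \<Longrightarrow> coprime (a i) N" "\<And>i. i \<in> I \<Longrightarrow> \<psi> i (a i) = -1"
      "\<And>i j. i \<in> I \<Longrightarrow> j \<in> I \<Longrightarrow> i \<noteq> j \<Longrightarrow> \<psi> j (a i) = 1"
    and \<epsilon>: "\<And>i. i \<in> I \<Longrightarrow> \<epsilon> i \<in> {-1, 1}" "\<exists>i\<in>I. \<epsilon> i = -1"
  shows "\<exists>p. prime p \<and> \<not> p dvd N \<and> (\<forall>i\<in>I. \<psi> i p = \<epsilon> i)"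
proof (rule ccontr)
  assume none: "\<not> ?thesis"
  \<comment> \<open>The hypotheses speak only of arguments coprime to \<open>N\<close>; extension by
    0 turns each product into a character, the principal one for the empty set.\<close>
  define X where "X S n = (if coprime n N then \<Prod>i\<in>S. \<psi> i n else 0)" for S n
  have character: "real_character N (X S)" if S: "S \<subseteq> I" for S
  proof
    fix x y :: nat
    show "X S (x * y) = X S x * X S y"
    proof (cases "coprime x N \<and> coprime y N")
      case True
      then have "(\<Prod>i\<in>S. \<psi> i (x * y)) = (\<Prod>i\<in>S. \<psi> i x * \<psi> i y)"
        using S mult by (intro prod.cong) auto
      then show ?thesis using True by (simp add: X_def prod.distrib)
    qed (auto simp: X_def)
    have "(\<Prod>i\<in>S. \<psi> i (x + N)) = (\<Prod>i\<in>S. \<psi> i x)" if "coprime x N"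
      using S periodic that by (intro prod.cong) auto
    moreover have "coprime (x + N) N \<longleftrightarrow> coprime x N"
      by (simp only: coprime_iff_gcd_eq_1 gcd_add1)
    ultimately show "X S (x + N) = X S x"
      by (simp add: X_def)
    have fin: "finite S" using finite_subset[OF S I] .
    have "(\<Prod>i\<in>S. \<psi> i x) \<in> {-1, 1}" if "coprime x N"
      using fin range[OF subsetD[OF S] that] by (rule prod_signs)
    then show "X S x \<in> {-1, 0, 1}" "X S x = 0 \<longleftrightarrow> \<not> coprime x N"
      by (auto simp: X_def)
  qed (rule N)
  define F where "F S s = (\<Sum>n. X S n * mangoldt n * real n powr - s)" for S s
  have bounded: "\<exists>C. \<forall>\<^sub>F s in at_right 1. \<bar>F S s\<bar> \<le> C" if S: "S \<in> Pow I - {{}}" for S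
  proof -
    from S obtain i where i: "i \<in> S" "S \<subseteq> I" by blast
    have fin: "finite S" using finite_subset[OF i(2) I] .
    have "(\<Prod>j\<in>S. \<psi> j (a i)) = \<psi> i (a i) * (\<Prod>j\<in>S - {i}. \<psi> j (a i))"
      using fin i(1) by (rule prod.remove)
    also have "(\<Prod>j\<in>S - {i}. \<psi> j (a i)) = 1"
      using a(3) i by (intro prod.neutral) auto
    finally have "X S (a i) = -1" using a i by (auto simp: X_def)
    then interpret nonprincipal_character N "X S"
      using character[OF i(2)] by (auto simp: nonprincipal_character_def nonprincipal_character_axioms_def)
    show ?thesis unfolding F_def using mangoldt_series_bounded by blast
  qed
  then obtain C where C: "\<And>S. S \<in> Pow I - {{}} \<Longrightarrow> \<forall>\<^sub>F s in at_right 1. \<bar>F S s\<bar> \<le> C S"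
    by metis
  define e where "e S = (\<Prod>i\<in>S. \<epsilon> i)" for S
  have abs_e: "\<bar>e S\<bar> = 1" if "S \<subseteq> I" for S
  proof -
    have "\<bar>\<epsilon> i\<bar> = 1" if "i \<in> S" for i using \<epsilon>(1)[OF subsetD[OF \<open>S \<subseteq> I\<close> that]] by auto
    then show ?thesis unfolding e_def abs_prod by simp
  qed
  \<comment> \<open>As \<open>e S\<close> is a sign, \<open>B\<close> bounds the joint contribution
    of the nonprincipal series near 1.\<close>
  define B where "B = (\<Sum>S\<in>Pow I - {{}}. C S)"
  interpret principal: real_character N "X {}" by (rule character) simp
  have "\<forall>\<^sub>F s in at_right 1. F {} s \<ge> B + 1"
    unfolding F_def by (rule principal.mangoldt_series_principal_at_top) (simp add: X_def)
  moreover have "\<forall>\<^sub>F s in at_right 1. \<forall>S\<in>Pow I - {{}}. \<bar>F S s\<bar> \<le> C S"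
    using I C by (intro eventually_ball_finite) auto
  moreover have "\<forall>\<^sub>F s in at_right (1::real). s > 1" by (simp add: eventually_at_right_less)
  ultimately have "\<forall>\<^sub>F s in at_right (1::real). False"
  proof eventually_elim
    case (elim s)
    have zero: "(\<Sum>S\<in>Pow I. e S * X S n) * mangoldt n = 0" for n
    proof (cases "coprime n N \<and> primepow n")
      case True
      then obtain p k where pk: "prime p" "k > 0" "n = p ^ k"
        by (auto simp: primepow_def)
      have p: "coprime p N" using True pk by simp
      have pow: "\<psi> i (p ^ j) = \<psi> i p ^ j" if "i \<in> I" "j > 0" for i j
        using that(2) by (induction j rule: nat_induct_non_zero) (use mult[OF that(1)] p in auto)
      have "\<exists>i\<in>I. \<psi> i n \<noteq> \<epsilon> i"
      proof (rule ccontr)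
        assume "\<not> ?thesis"
        then have all: "\<psi> i p ^ k = \<epsilon> i" if "i \<in> I" for i using that pow pk by auto
        obtain i0 where i0: "i0 \<in> I" "\<epsilon> i0 = -1" using \<epsilon>(2) by blast
        have "odd k"
        proof
          assume "even k"
          then have "\<psi> i0 p ^ k \<ge> 0" by (rule zero_le_even_power)
          then show False using all[OF i0(1)] i0(2) by simp
        qed
        then have "\<psi> i p = \<epsilon> i" if "i \<in> I" for i
          using all[OF that] range[OF that p] by auto
        moreover have "\<not> p dvd N"
          using p pk(1) by (metis coprime_absorb_left not_prime_unit)
        ultimately show False using none pk(1) by blast
      qed
      then obtain i where i: "i \<in> I" "\<psi> i n \<noteq> \<epsilon> i" by blast
      then have "1 + \<epsilon> i * \<psi> i n = 0" using range[OF i(1), of n] \<epsilon>(1)[OF i(1)] True by auto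
      then have "(\<Prod>i\<in>I. 1 + \<epsilon> i * \<psi> i n) = 0" using I i by (auto intro: prod_zero)
      then have "(\<Sum>S\<in>Pow I. e S * X S n) = 0"
        using True sum_Pow_prod_signs[OF I, of "\<lambda>i. \<epsilon> i * \<psi> i n"] by (simp add: X_def e_def prod.distrib)
      then show ?thesis by simp
    next
      case False
      then show ?thesis by (auto simp: X_def mangoldt_def)
    qed
    have summ: "summable (\<lambda>n. X S n * mangoldt n * real n powr - s)" if "S \<subseteq> I" for S
      using real_character.summable_abs_L_mangoldt[OF character[OF that] elim(3)]
      by (rule summable_rabs_cancel)
    have "(\<Sum>S\<in>Pow I. e S * F S s) = (\<Sum>S\<in>Pow I. \<Sum>n. e S * (X S n * mangoldt n * real n powr - s))"
      unfolding F_def by (intro sum.cong refl suminf_mult[symmetric] summ) auto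
    also have "\<dots> = (\<Sum>n. \<Sum>S\<in>Pow I. e S * (X S n * mangoldt n * real n powr - s))"
      by (intro suminf_sum[symmetric] summable_mult summ) auto
    also have "\<dots> = (\<Sum>n. (\<Sum>S\<in>Pow I. e S * X S n) * mangoldt n * real n powr - s)"
      by (simp only: sum_distrib_right mult.assoc)
    also have "\<dots> = 0" unfolding zero by simp
    finally have "e {} * F {} s + (\<Sum>S\<in>Pow I - {{}}. e S * F S s) = 0"
      using I by (subst (asm) sum.remove[of _ "{}"]) auto
    then have "F {} s = - (\<Sum>S\<in>Pow I - {{}}. e S * F S s)" by (simp add: e_def)
    also have "\<dots> \<le> (\<Sum>S\<in>Pow I - {{}}. \<bar>e S * F S s\<bar>)" using sum_abs abs_le_D2 by fast
    also have "\<dots> \<le> B"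
      unfolding B_def using elim(2) abs_e by (intro sum_mono) (auto simp: abs_mult)
    finally show False using elim(1) by linarith
  qed
  then show False by simp
qed

section \<open>Primes with prescribed Legendre symbols\<close>

lemma Legendre_values: "Legendre a p \<in> {-1, 0, 1}"
  by (simp add: Legendre_def)

lemma Legendre_cong: "a mod p = b mod p \<Longrightarrow> Legendre a p = Legendre b p"
  by (simp add: Legendre_def QuadRes_def unique_euclidean_semiring_class.cong_def)

lemma Legendre_eq_0_iff: "Legendre a p = 0 \<longleftrightarrow> p dvd a"
  by (auto simp: Legendre_def cong_0_iff)

text \<open>Turns the congruences of Euler's criterion into equalities: two such values differ by at
  most 2, hence by less than \<open>p\<close>.\<close>

lemma sign_cong_imp_eq:
  fixes x y :: int
  assumes "[x = y] (mod int p)" "x \<in> {-1, 0, 1}" "y \<in> {-1, 0, 1}" "2 < p"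
  shows "x = y"
proof -
  have "int p dvd x - y" using assms(1) by (simp add: cong_iff_dvd_diff)
  moreover have "\<bar>x - y\<bar> < int p" using assms by auto
  ultimately show ?thesis using dvd_imp_le_int[of "x - y" "int p"] by fastforce
qed

lemma Legendre_mult:
  assumes p: "prime p" "2 < p"
  shows "Legendre (a * b) (int p) = Legendre a (int p) * Legendre b (int p)"
proof (rule sign_cong_imp_eq)
  let ?h = "(p - 1) div 2"
  have "[Legendre (a * b) (int p) = (a * b) ^ ?h] (mod int p)"
    using euler_criterion[OF p] .
  moreover have "[Legendre a (int p) * Legendre b (int p) = a ^ ?h * b ^ ?h] (mod int p)"
    by (intro cong_mult euler_criterion p)
  ultimately show "[Legendre (a * b) (int p) = Legendre a (int p) * Legendre b (int p)] (mod int p)"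
    by (metis cong_sym cong_trans power_mult_distrib)
  show "Legendre a (int p) * Legendre b (int p) \<in> {-1, 0, 1}"
    using Legendre_values[of a "int p"] Legendre_values[of b "int p"] by auto
qed (use p Legendre_values in auto)

lemma Legendre_1 [simp]: "2 < p \<Longrightarrow> Legendre 1 (int p) = 1"
proof -
  assume "2 < p"
  then have "Legendre 1 (int p) \<noteq> 0" by (auto simp: Legendre_eq_0_iff)
  moreover have "QuadRes (int p) 1" unfolding QuadRes_def by (rule exI[of _ 1]) simp
  ultimately show ?thesis by (auto simp: Legendre_def)
qed

lemma Legendre_prod:
  assumes "prime p" "2 < p" "finite Q"
  shows "Legendre (\<Prod>q\<in>Q. f q) (int p) = (\<Prod>q\<in>Q. Legendre (f q) (int p))"
  using assms(3) by (induction Q) (simp_all add: Legendre_mult assms)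

text \<open>On odd \<open>n\<close> this is the Jacobi symbol (-1/n), and \<open>sign_mod8\<close>
  below is (2/n); at even \<open>n\<close> both take the default value -1.\<close>

definition sign_mod4 :: "nat \<Rightarrow> int" where
  "sign_mod4 n = (if n mod 4 = 1 then 1 else -1)"

definition sign_mod8 :: "nat \<Rightarrow> int" where
  "sign_mod8 n = (if n mod 8 = 1 \<or> n mod 8 = 7 then 1 else -1)"

lemma odd_mod8_cases:
  fixes n :: nat
  assumes "odd n"
  obtains "n mod 8 = 1" | "n mod 8 = 3" | "n mod 8 = 5" | "n mod 8 = 7"
proof -
  have "n mod 8 = 1 \<or> n mod 8 = 3 \<or> n mod 8 = 5 \<or> n mod 8 = 7"
    using assms by presburger
  then show ?thesis using that by blast
qed

lemma mod4_of_mod8: "(n::nat) mod 4 = (n mod 8) mod 4"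
  by (simp add: mod_mod_cancel)

lemma sign_mod_mult:
  assumes "odd x" "odd y"
  shows "sign_mod4 (x * y) = sign_mod4 x * sign_mod4 y"
    and "sign_mod8 (x * y) = sign_mod8 x * sign_mod8 y"
proof -
  have xy: "(x * y) mod 8 = ((x mod 8) * (y mod 8)) mod 8" by (simp add: mod_mult_eq)
  show "sign_mod4 (x * y) = sign_mod4 x * sign_mod4 y"
    unfolding sign_mod4_def mod4_of_mod8[of "x * y"] mod4_of_mod8[of x] mod4_of_mod8[of y] xy
    using assms by (elim odd_mod8_cases) simp_all
  show "sign_mod8 (x * y) = sign_mod8 x * sign_mod8 y"
    unfolding sign_mod8_def xy using assms by (elim odd_mod8_cases) simp_all
qed

lemma Legendre_minus_1:
  assumes "prime p" "2 < p"
  shows "Legendre (-1) (int p) = sign_mod4 p"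
proof (rule sign_cong_imp_eq)
  have "odd p" using assms prime_odd_nat by blast
  have "even ((p - 1) div 2) \<longleftrightarrow> p mod 4 = 1"
    using \<open>odd p\<close> by presburger
  then have "(-1 :: int) ^ ((p - 1) div 2) = sign_mod4 p"
    by (simp add: sign_mod4_def)
  then show "[Legendre (-1) (int p) = sign_mod4 p] (mod int p)"
    using euler_criterion[OF assms, of "-1"] by simp
qed (use assms Legendre_values in \<open>auto simp: sign_mod4_def\<close>)

lemma Legendre_2:
  assumes p: "prime p" "2 < p"
  shows "Legendre 2 (int p) = sign_mod8 p"
proof -
  have "odd p" using assms prime_odd_nat by blast
  have "\<not> int p dvd 2" using p by (auto dest!: zdvd_imp_le)
  then interpret GAUSS p 2
    using p by unfold_locales (auto simp: cong_0_iff)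
  define h where "h = (int p - 1) div 2"
  have h: "int p = 2 * h + 1" "h > 0" using \<open>odd p\<close> p unfolding h_def by presburger+
  have "C = (\<lambda>x. x * 2) ` {0<..h}"
    unfolding C_def B_def A_def h_def[symmetric] image_image
    using h by (intro image_cong) auto
  \<comment> \<open>Gauss' lemma counts the doubles \<open>2 * x\<close> with
    \<open>x \<le> h\<close> that exceed \<open>h\<close>, so those with
    \<open>x > h div 2\<close>.\<close>
  then have "E = (\<lambda>x. x * 2) ` {h div 2<..h}"
    unfolding E_def h_def[symmetric] using h by (auto simp: image_iff)
  then have card: "card E = nat (h - h div 2)"
    by (simp add: card_image inj_on_def)
  obtain k where k: "h = int k" using h(2) by (metis nonneg_int_cases less_imp_le)
  have p_eq: "p = 2 * k + 1" using h(1) k by simp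
  have "nat (h - h div 2) = k - k div 2" using k by linarith
  then have "even (nat (h - h div 2)) \<longleftrightarrow> p mod 8 = 1 \<or> p mod 8 = 7"
  proof -
    \<comment> \<open>With \<open>p = 2 * k + 1\<close> and \<open>k = r + 4 * j\<close>, both the
      parity and \<open>p mod 8\<close> depend on \<open>r\<close> alone.\<close>
    obtain j r where j: "k = r + 4 * j" "r < 4"
      by (metis mod_less_divisor mod_mult_div_eq zero_less_numeral add.commute)
    have p8: "p mod 8 = (2 * r + 1) mod 8"
      using mod_mult_self2[of "2 * r + 1" 8 j] by (simp add: p_eq j(1) algebra_simps)
    have "r = 0 \<or> r = 1 \<or> r = 2 \<or> r = 3" using j(2) by linarith
    moreover have "k - k div 2 = (r - r div 2) + 2 * j" using j(1) by linarith
    then have "even (nat (h - h div 2)) \<longleftrightarrow> even (r - r div 2)"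
      unfolding \<open>nat (h - h div 2) = k - k div 2\<close> by (simp only: even_add) simp
    ultimately show ?thesis unfolding p8 by (elim disjE) simp_all
  qed
  then show ?thesis
    unfolding gauss_lemma card by (simp add: sign_mod8_def)
qed

lemma sign_mod_prod:
  assumes "finite Q" "\<And>q. q \<in> Q \<Longrightarrow> odd q"
  shows "sign_mod4 (\<Prod>Q) = (\<Prod>q\<in>Q. sign_mod4 q)" "sign_mod8 (\<Prod>Q) = (\<Prod>q\<in>Q. sign_mod8 q)"
proof -
  have "odd (\<Prod>Q) \<and> sign_mod4 (\<Prod>Q) = (\<Prod>q\<in>Q. sign_mod4 q) \<and> sign_mod8 (\<Prod>Q) = (\<Prod>q\<in>Q. sign_mod8 q)"
    using assms
  proof (induction Q)
    case (insert q Q)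
    then have "odd q" "odd (\<Prod>Q)" by blast+
    then show ?case using insert by (simp add: sign_mod_mult)
  qed (simp add: sign_mod4_def sign_mod8_def)
  then show "sign_mod4 (\<Prod>Q) = (\<Prod>q\<in>Q. sign_mod4 q)" "sign_mod8 (\<Prod>Q) = (\<Prod>q\<in>Q. sign_mod8 q)"
    by blast+
qed

text \<open>Otherwise squaring would map the nonzero residues onto themselves, hence injectively,
  against \<open>(q - 1)^2 = 1\<close> modulo \<open>q\<close>.\<close>

lemma quadratic_nonresidue_exists:
  assumes q: "prime q" "2 < q"
  obtains a where "Legendre (int a) (int q) = -1"
proof (rule ccontr)
  assume none: "\<not> thesis"
  define f where "f x = x ^ 2 mod q" for x
  have "{1..<q} \<subseteq> f ` {1..<q}"
  proof
    fix a assume a: "a \<in> {1..<q}"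
    then have "\<not> int q dvd int a" by (auto dest: dvd_imp_le)
    moreover have "Legendre (int a) (int q) \<noteq> -1" using none that by blast
    ultimately have "QuadRes (int q) (int a)"
      by (auto simp: Legendre_def cong_0_iff split: if_splits)
    then obtain y where y: "[y ^ 2 = int a] (mod int q)" unfolding QuadRes_def by blast
    define x where "x = nat (y mod int q)"
    have x: "int x = y mod int q" using q by (simp add: x_def)
    have "int (f x) = int a"
    proof -
      have "int (f x) = (y mod int q) ^ 2 mod int q" by (simp add: f_def zmod_int x)
      also have "\<dots> = y ^ 2 mod int q" by (simp add: power_mod)
      also have "\<dots> = int a mod int q"
        using y by (simp add: unique_euclidean_semiring_class.cong_def)
      also have "\<dots> = int a" using a by simp
      finally show ?thesis .
    qed
    then have "f x = a" by simp
    moreover have "x < q" using x q by (simp add: x_def nat_less_iff)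
    moreover have "x \<noteq> 0"
    proof
      assume "x = 0"
      then show False using \<open>f x = a\<close> a by (simp add: f_def)
    qed
    ultimately show "a \<in> f ` {1..<q}" by force
  qed
  then have inj: "inj_on f {1..<q}" by (intro finite_surj_inj) auto
  have "f (q - 1) = f 1"
  proof -
    obtain r where "q = 2 + r" using q le_Suc_ex[of 2 q] by auto
    then have "(q - 1) ^ 2 = 1 + (q - 2) * q" by (simp add: power2_eq_square algebra_simps)
    moreover have "(1 + (q - 2) * q) mod q = 1 mod q" by (rule mod_mult_self1)
    ultimately show ?thesis by (simp only: f_def power_one)
  qed
  then have "q - 1 = 1" by (rule inj_onD[OF inj]) (use q in auto)
  then show False using q by simp
qed

lemma negated_square_mod_prod:
  fixes m :: int
  assumes "finite P" "\<And>q. q \<in> P \<Longrightarrow> prime q" "\<And>q. q \<in> P \<Longrightarrow> \<exists>b. int q dvd b\<^sup>2 + m"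
  shows "\<exists>b. int (\<Prod>P) dvd b\<^sup>2 + m"
  using assms
proof (induction P)
  case (insert q P)
  then obtain b c where b: "int (\<Prod>P) dvd b\<^sup>2 + m" and c: "int q dvd c\<^sup>2 + m" by blast
  have "coprime q (\<Prod>P)"
    using insert by (intro prod_coprime_right) (auto intro!: primes_coprime)
  then have cop: "coprime (int q) (int (\<Prod>P))" by (simp only: coprime_int_iff)
  then obtain x where x: "[x = c] (mod int q)" "[x = b] (mod int (\<Prod>P))"
    using binary_chinese_remainder_int by blast
  have "[x\<^sup>2 + m = c\<^sup>2 + m] (mod int q)" "[x\<^sup>2 + m = b\<^sup>2 + m] (mod int (\<Prod>P))"
    using x by (intro cong_add cong_pow cong_refl; simp)+
  then have "int q dvd x\<^sup>2 + m" "int (\<Prod>P) dvd x\<^sup>2 + m"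
    using b c cong_dvd_iff by blast+
  then have "int q * int (\<Prod>P) dvd x\<^sup>2 + m"
    using cop by (rule divides_mult)
  then show ?case using insert by (auto simp del: of_nat_prod)
qed simp

lemma Legendre_reciprocity_1_mod_4:
  assumes "prime p" "2 < p" "prime q" "2 < q" "p \<noteq> q" and p: "p mod 4 = 1"
  shows "Legendre (int q) (int p) = Legendre (int p) (int q)"
proof -
  have "even ((p - 1) div 2)" using p by presburger
  then have "Legendre (int p) (int q) * Legendre (int q) (int p) = 1"
    using Quadratic_Reciprocity[OF assms(1-5)] by simp
  then show ?thesis
    using Legendre_values[of "int p" "int q"] Legendre_values[of "int q" "int p"] by auto
qed

lemma mod_eq_mono_dvd:
  fixes a b m d :: nat
  assumes "a mod m = b mod m" "d dvd m"
  shows "a mod d = b mod d"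
  using assms by (metis mod_mod_cancel)

text \<open>Meant for the dual basis: a chosen symbol at one modulus, and residue 1 elsewhere, where
  every symbol is 1.\<close>

lemma chinese_remainder_one:
  fixes m m' c :: nat
  assumes "coprime m m'" "coprime c m"
  obtains a where "a mod m = c mod m" "a mod m' = 1 mod m'" "coprime a (m * m')"
proof -
  obtain a where a: "[a = c] (mod m)" "[a = 1] (mod m')"
    using binary_chinese_remainder_nat[OF assms(1)] by blast
  have "coprime a m" using a(1) assms(2) by (metis cong_imp_coprime cong_sym)
  moreover have "coprime a m'" using a(2) by (metis cong_imp_coprime cong_sym coprime_1_left)
  ultimately show ?thesis
    using that a by (simp add: unique_euclidean_semiring_class.cong_def)
qed

lemma prime_with_Legendre_symbols:
  fixes Q :: "nat set" and \<delta> :: "nat \<Rightarrow> int" and e :: int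
  assumes Q: "finite Q" "\<And>q. q \<in> Q \<Longrightarrow> prime q" "\<And>q. q \<in> Q \<Longrightarrow> 2 < q"
    and \<delta>: "\<And>q. q \<in> Q \<Longrightarrow> \<delta> q \<in> {-1, 1}" and e: "e \<in> {-1, 1}"
  obtains p where "prime p" "2 < p" "p mod 4 = 1" "sign_mod8 p = e"
    "\<And>q. q \<in> Q \<Longrightarrow> Legendre (int p) (int q) = \<delta> q"
proof -
  \<comment> \<open>The auxiliary prime \<open>r\<close> provides the sign \<open>-1\<close> that \<open>prime_with_prescribed_signs\<close> requires.\<close>
  obtain r where r: "prime r" "r > \<Sum>Q + 2" using bigger_prime by blast
  have r_notin: "r \<notin> Q" using member_le_sum[of r Q "\<lambda>x. x"] Q(1) r(2) by auto
  define Q' where "Q' = insert r Q"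
  have Q': "finite Q'" "\<And>q. q \<in> Q' \<Longrightarrow> prime q" "\<And>q. q \<in> Q' \<Longrightarrow> 2 < q"
    using Q r by (auto simp: Q'_def)
  have Q'48: "q \<noteq> 4" "q \<noteq> 8" if "q \<in> Q'" for q
    using Q'(2)[OF that] prime_odd_nat[OF Q'(2,3)[OF that]] by auto
  define M where "M = \<Prod>Q'"
  define N where "N = 8 * M"
  have q_dvd: "q dvd M" if "q \<in> Q'" for q
    unfolding M_def using Q'(1) that by (rule dvd_prodI)
  have "coprime 2 M"
    unfolding M_def using prime_odd_nat[OF Q'(2,3)] by (intro prod_coprime_right) simp
  then have cop8: "coprime (2 ^ 3) M" by (subst coprime_power_left_iff) simp
  then have cop8: "coprime 8 M" by simp
  have M0: "M > 0" unfolding M_def using Q'(3) by (intro prod_pos) force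
  have coprimeD: "odd x" "\<And>q. q \<in> Q' \<Longrightarrow> \<not> int q dvd int x" if "coprime x N" for x
  proof -
    have "coprime x 2" using that unfolding N_def
      by (metis coprime_mult_right_iff numeral_Bit0 mult_2 dvd_triv_left coprime_divisors dvd_refl even_numeral)
    then show "odd x" by simp
    fix q assume q: "q \<in> Q'"
    then have "coprime x q" using that q_dvd[OF q] unfolding N_def
      by (metis coprime_divisors dvd_mult dvd_refl)
    moreover have "\<not> is_unit q" using Q'(3)[OF q] by simp
    ultimately show "\<not> int q dvd int x" by (metis coprime_common_divisor dvd_refl int_dvd_int_iff)
  qed
  \<comment> \<open>The indices 4 and 8 stand for the two sign characters; the indices in
    \<open>Q'\<close> are odd primes, so nothing clashes.\<close>
  define \<psi> :: "nat \<Rightarrow> nat \<Rightarrow> real" where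
    "\<psi> i x = of_int (if i = 4 then sign_mod4 x else if i = 8 then sign_mod8 x
                      else Legendre (int x) (int i))" for i x
  define \<epsilon> :: "nat \<Rightarrow> real" where
    "\<epsilon> i = of_int (if i = 4 then 1 else if i = 8 then e else if i = r then -1 else \<delta> i)" for i
  let ?I = "{4, 8} \<union> Q'"
  have \<psi>_Q: "\<psi> q x = of_int (Legendre (int x) (int q))" if "q \<in> Q'" for q x
    using Q'48[OF that] by (simp add: \<psi>_def)
  have one: "\<psi> q x = 1" if "q \<in> Q'" "x mod q = 1 mod q" for q x
  proof -
    have "int x mod int q = 1 mod int q" using that(2) by (metis of_nat_1 zmod_int)
    then have "Legendre (int x) (int q) = Legendre 1 (int q)" by (rule Legendre_cong)
    then show ?thesis
      using \<psi>_Q[OF that(1)] Legendre_1[OF Q'(3)[OF that(1)]] by simp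
  qed
  have dual: "\<exists>a. coprime a N \<and> \<psi> i a = -1 \<and> (\<forall>j\<in>?I. i \<noteq> j \<longrightarrow> \<psi> j a = 1)" if i: "i \<in> ?I" for i
  proof -
    consider "i = 4" | "i = 8" | "i \<in> Q'" using i by blast
    then show ?thesis
    proof cases
      case 1
      \<comment> \<open>The residue 7 has \<open>sign_mod4\<close> equal to -1 and
        \<open>sign_mod8\<close> equal to 1; for the index 8 below, 5 has these signs
        exchanged.\<close>
      have "coprime (7::nat) (2 ^ 3)" by (subst coprime_power_right_iff) simp
      then obtain a where a: "a mod 8 = 7 mod 8" "a mod M = 1 mod M" "coprime a (8 * M)"
        using chinese_remainder_one[OF cop8, of 7] by auto
      have "\<psi> q a = 1" if "q \<in> Q'" for q
        using one[OF that mod_eq_mono_dvd[OF a(2) q_dvd[OF that]]] .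
      moreover have "\<psi> 4 a = -1" "\<psi> 8 a = 1"
        using a(1) by (simp_all add: \<psi>_def sign_mod4_def sign_mod8_def mod4_of_mod8[of a])
      moreover have "coprime a N" using a(3) by (simp only: N_def)
      ultimately show ?thesis using 1 by (intro exI[of _ a]) auto
    next
      case 2
      have "coprime (5::nat) (2 ^ 3)" by (subst coprime_power_right_iff) simp
      then obtain a where a: "a mod 8 = 5 mod 8" "a mod M = 1 mod M" "coprime a (8 * M)"
        using chinese_remainder_one[OF cop8, of 5] by auto
      have "\<psi> q a = 1" if "q \<in> Q'" for q
        using one[OF that mod_eq_mono_dvd[OF a(2) q_dvd[OF that]]] .
      moreover have "\<psi> 4 a = 1" "\<psi> 8 a = -1"
        using a(1) by (simp_all add: \<psi>_def sign_mod4_def sign_mod8_def mod4_of_mod8[of a])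
      moreover have "coprime a N" using a(3) by (simp only: N_def)
      ultimately show ?thesis using 2 by (intro exI[of _ a]) auto
    next
      case 3
      define M' where "M' = \<Prod>(Q' - {i})"
      have MM': "M = i * M'"
        unfolding M_def M'_def using Q'(1) 3 by (rule prod.remove)
      have "coprime i M'"
        unfolding M'_def using Q'(2) 3 by (intro prod_coprime_right primes_coprime) auto
      moreover have "coprime i 8" using cop8 MM' by (simp add: coprime_commute)
      ultimately have cop: "coprime i (8 * M')" by simp
      obtain c where c: "Legendre (int c) (int i) = -1"
        using quadratic_nonresidue_exists[OF Q'(2,3)[OF 3]] .
      then have "\<not> i dvd c" using Legendre_eq_0_iff[of "int c" "int i"] by auto
      then have "coprime c i" using prime_imp_coprime[OF Q'(2)[OF 3]] by (metis coprime_commute)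
      then obtain a where a: "a mod i = c mod i" "a mod (8 * M') = 1 mod (8 * M')" "coprime a (i * (8 * M'))"
        using chinese_remainder_one[OF cop] by blast
      have "int a mod int i = int c mod int i" using a(1) by (metis zmod_int)
      then have "Legendre (int a) (int i) = Legendre (int c) (int i)" by (rule Legendre_cong)
      then have "\<psi> i a = -1" using c \<psi>_Q[OF 3] by simp
      moreover have a8: "a mod 8 = 1" using mod_eq_mono_dvd[OF a(2), of 8] by simp
      then have "\<psi> 4 a = 1" "\<psi> 8 a = 1"
        by (auto simp: \<psi>_def sign_mod4_def sign_mod8_def mod4_of_mod8[of a])
      moreover have "\<psi> q a = 1" if "q \<in> Q'" "q \<noteq> i" for q
      proof -
        have "q dvd M'" unfolding M'_def using Q'(1) that by (intro dvd_prodI) auto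
        then have "q dvd 8 * M'" by simp
        then show ?thesis using one[OF that(1) mod_eq_mono_dvd[OF a(2)]] by blast
      qed
      moreover have "coprime a N" using a(3) by (simp only: N_def MM' mult.left_commute)
      ultimately show ?thesis by (intro exI[of _ a]) auto
    qed
  qed
  then have "\<exists>a. \<forall>i\<in>?I. coprime (a i) N \<and> \<psi> i (a i) = -1 \<and> (\<forall>j\<in>?I. i \<noteq> j \<longrightarrow> \<psi> j (a i) = 1)"
    by (intro bchoice ballI)
  then obtain a where
    a': "\<forall>i\<in>?I. coprime (a i) N \<and> \<psi> i (a i) = -1 \<and> (\<forall>j\<in>?I. i \<noteq> j \<longrightarrow> \<psi> j (a i) = 1)"
    by (rule exE)
  have a: "coprime (a i) N" "\<psi> i (a i) = -1" "\<And>j. j \<in> ?I \<Longrightarrow> i \<noteq> j \<Longrightarrow> \<psi> j (a i) = 1"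
    if "i \<in> ?I" for i
    using bspec[OF a' that] by blast+
  have "\<exists>p. prime p \<and> \<not> p dvd N \<and> (\<forall>i\<in>?I. \<psi> i p = \<epsilon> i)"
  proof (rule prime_with_prescribed_signs[where N = N and I = ?I and \<psi> = \<psi> and \<epsilon> = \<epsilon> and a = a])
    show "N > 1" using M0 by (simp add: N_def)
    show "finite ?I" using Q'(1) by simp
    fix i assume i: "i \<in> ?I"
    show "coprime (a i) N" "\<psi> i (a i) = -1" using a(1,2)[OF i] .
    show "\<psi> j (a i) = 1" if "j \<in> ?I" "i \<noteq> j" for j using a(3)[OF i that] .
    show "\<epsilon> i \<in> {-1, 1}" using i e \<delta>[of i] by (auto simp: \<epsilon>_def Q'_def)
    fix x assume x: "coprime x N"
    have N8: "8 dvd N" by (simp add: N_def)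
    have "(x + N) mod 8 = x mod 8" using N8 by auto
    moreover have "int (x + N) mod int q = int x mod int q" if "q \<in> Q'" for q
    proof -
      have "q dvd N" using q_dvd[OF that] by (simp add: N_def)
      then have "(x + N) mod q = x mod q" by auto
      then show ?thesis by (metis zmod_int)
    qed
    ultimately show "\<psi> i (x + N) = \<psi> i x"
      using i by (auto simp: \<psi>_def sign_mod4_def sign_mod8_def mod4_of_mod8[of "x + N"] mod4_of_mod8[of x]
        intro: Legendre_cong simp del: of_nat_add)
    show "\<psi> i x \<in> {-1, 1}"
    proof (cases "i \<in> Q'")
      case True
      have "Legendre (int x) (int i) \<noteq> 0" using coprimeD(2)[OF x True] by (simp add: Legendre_eq_0_iff)
      then show ?thesis using \<psi>_Q[OF True] Legendre_values[of "int x" "int i"] by auto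
    qed (use i in \<open>auto simp: \<psi>_def sign_mod4_def sign_mod8_def\<close>)
    fix y assume y: "coprime y N"
    show "\<psi> i (x * y) = \<psi> i x * \<psi> i y"
    proof (cases "i \<in> Q'")
      case True
      then show ?thesis by (simp add: \<psi>_Q Legendre_mult[OF Q'(2,3)])
    qed (use i sign_mod_mult[OF coprimeD(1)[OF x] coprimeD(1)[OF y]] in \<open>auto simp: \<psi>_def\<close>)
  next
    have "r \<in> ?I" "\<epsilon> r = -1" using Q'48[of r] by (auto simp: Q'_def \<epsilon>_def)
    then show "\<exists>i\<in>?I. \<epsilon> i = -1" by blast
  qed
  then obtain p where p: "prime p" "\<not> p dvd N" "\<And>i. i \<in> ?I \<Longrightarrow> \<psi> i p = \<epsilon> i" by blast
  have "p \<noteq> 2" using p(2) by (auto simp: N_def)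
  then have "2 < p" using prime_ge_2_nat[OF p(1)] by simp
  moreover have "p mod 4 = 1" using p(3)[of 4] by (auto simp: \<psi>_def \<epsilon>_def sign_mod4_def split: if_splits)
  moreover have "sign_mod8 p = e" using p(3)[of 8] by (simp add: \<psi>_def \<epsilon>_def)
  moreover have "Legendre (int p) (int q) = \<delta> q" if "q \<in> Q" for q
  proof -
    have "q \<in> Q'" "q \<noteq> r" using that r_notin by (auto simp: Q'_def)
    then show ?thesis using p(3)[of q] \<psi>_Q[of q p] Q'48[of q] by (simp add: \<epsilon>_def)
  qed
  ultimately show ?thesis using that p(1) by blast
qed

section \<open>Sums of three squares\<close>

lemma squarefree_eq_prod_prime_factors:
  fixes n :: nat
  assumes "squarefree n"
  shows "n = \<Prod>(prime_factors n)"
proof -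
  have n: "n > 0" using assms by (cases "n = 0") auto
  then have "n = (\<Prod>p\<in>prime_factors n. p ^ multiplicity p n)" by (rule prime_factorization_nat)
  also have "\<dots> = (\<Prod>p\<in>prime_factors n. p)"
    using assms n by (intro prod.cong) (auto simp: squarefree_factorial_semiring')
  finally show ?thesis .
qed

lemma QuadRes_if_Legendre_1: "Legendre a p = 1 \<Longrightarrow> \<exists>b. p dvd b\<^sup>2 - a"
  by (auto simp: Legendre_def QuadRes_def cong_iff_dvd_diff split: if_splits)

lemma sign_sq: "x \<in> {-1, 1} \<Longrightarrow> x * x = (1::int)"
  by auto

lemma three_squares_squarefree:
  fixes n :: nat
  assumes sf: "squarefree n" and n7: "n mod 8 \<noteq> 7"
  shows "\<exists>a b c :: int. int n = a\<^sup>2 + b\<^sup>2 + c\<^sup>2"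
proof -
  have n0: "n > 0" using sf by (cases "n = 0") auto
  define Q where "Q = prime_factors n - {2}"
  define u where "u = \<Prod>Q"
  have Q: "finite Q" "\<And>q. q \<in> Q \<Longrightarrow> prime q" "\<And>q. q \<in> Q \<Longrightarrow> 2 < q"
  proof -
    show "prime q" if "q \<in> Q" for q using that by (auto simp: Q_def)
    then show "2 < q" if "q \<in> Q" for q
      using that prime_ge_2_nat[of q] by (auto simp: Q_def)
  qed (simp add: Q_def)
  have Q_odd: "odd q" if "q \<in> Q" for q using prime_odd_nat Q(2,3)[OF that] by blast
  have n_eq: "n = (if even n then 2 else 1) * u"
  proof (cases "even n")
    case True
    then have "2 \<in> prime_factors n" using n0 by (simp add: prime_factors_dvd)
    then show ?thesis
      using squarefree_eq_prod_prime_factors[OF sf] prod.remove[of "prime_factors n" 2 "\<lambda>x. x"] True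
      by (simp add: u_def Q_def)
  next
    case False
    then have "2 \<notin> prime_factors n" by (auto simp: prime_factors_dvd)
    then show ?thesis
      using squarefree_eq_prod_prime_factors[OF sf] False by (simp add: u_def Q_def)
  qed
  define c :: int where "c = (if n mod 8 = 3 then 2 else 1)"
  \<comment> \<open>Chosen so that the symbol of \<open>- m = - c * p\<close> at \<open>q\<close>
    becomes the square of \<open>\<delta> q\<close>, which is 1.\<close>
  define \<delta> where "\<delta> q = Legendre (- c) (int q)" for q :: nat
  have \<delta>_eq: "\<delta> q = (if n mod 8 = 3 then sign_mod4 q * sign_mod8 q else sign_mod4 q)" if "q \<in> Q" for q
    unfolding \<delta>_def c_def
    using Legendre_mult[OF Q(2,3)[OF that], of "-1" 2] Legendre_minus_1[OF Q(2,3)[OF that]]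
      Legendre_2[OF Q(2,3)[OF that]] by simp
  then have \<delta>: "\<delta> q \<in> {-1, 1}" if "q \<in> Q" for q
    using that by (auto simp: sign_mod4_def sign_mod8_def)
  \<comment> \<open>The symbol of 2 at \<open>p\<close>. For even \<open>n = 2 * u\<close> it must
    equal the symbol of \<open>u\<close> at \<open>p\<close>, which will be
    \<open>sign_mod4 u\<close>; for odd \<open>n\<close> the choice is free.\<close>
  define e where "e = (if even n then sign_mod4 u else 1)"
  have e: "e \<in> {-1, 1}" by (simp add: e_def sign_mod4_def)
  obtain p where p: "prime p" "2 < p" "p mod 4 = 1" "sign_mod8 p = e"
    and pQ: "\<And>q. q \<in> Q \<Longrightarrow> Legendre (int p) (int q) = \<delta> q"
  proof (rule prime_with_Legendre_symbols[of Q \<delta> e])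
    show "e \<in> {-1, 1}" by (rule e)
  qed (use Q \<delta> that in blast)+
  have p_odd: "odd p" using prime_odd_nat p(1,2) by blast
  have p_notin: "p \<notin> Q"
  proof
    assume "p \<in> Q"
    then have "\<delta> p = 0" using pQ[of p] Legendre_eq_0_iff[of "int p" "int p"] by simp
    then show False using \<delta>[OF \<open>p \<in> Q\<close>] by simp
  qed
  have p_ndvd: "\<not> p dvd n"
    using p_notin p(1,2) n0 by (auto simp: Q_def prime_factors_dvd)
  define m :: int where "m = c * int p"
  have m0: "m > 0" using p(2) by (simp add: m_def c_def)
  have n_odd: "odd n" if "c = 2"
  proof -
    have "n mod 8 = 3" using that by (simp add: c_def split: if_splits)
    then show ?thesis by presburger
  qed

  have "Legendre (int u) (int p) = (\<Prod>q\<in>Q. Legendre (int q) (int p))"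
    unfolding u_def using Legendre_prod[OF p(1,2) Q(1), of int] by simp
  also have "\<dots> = (\<Prod>q\<in>Q. \<delta> q)"
  proof (rule prod.cong)
    fix q assume q: "q \<in> Q"
    then have "p \<noteq> q" using p_notin by blast
    then show "Legendre (int q) (int p) = \<delta> q"
      using Legendre_reciprocity_1_mod_4[OF p(1,2) Q(2,3)[OF q] _ p(3)] pQ[OF q] by simp
  qed simp
  also have "\<dots> = (if n mod 8 = 3 then sign_mod4 u * sign_mod8 u else sign_mod4 u)"
    using \<delta>_eq sign_mod_prod[OF Q(1) Q_odd] by (simp add: u_def prod.distrib)
  finally have Lu: "Legendre (int u) (int p) = (if n mod 8 = 3 then sign_mod4 u * sign_mod8 u else sign_mod4 u)" .
  have Ln: "Legendre (int n) (int p) = 1"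
  proof (cases "even n")
    case True
    then have n2: "int n = 2 * int u" using n_eq by simp
    have "n mod 8 \<noteq> 3" using True by presburger
    then have "Legendre (int n) (int p) = sign_mod4 u * sign_mod4 u"
      unfolding n2 using Legendre_mult[OF p(1,2)] Legendre_2[OF p(1,2)] p(4) Lu True by (simp add: e_def)
    then show ?thesis by (simp add: sign_mod4_def)
  next
    case False
    then have nu: "u = n" using n_eq by simp
    \<comment> \<open>The residues 1, 3 and 5 modulo 8 all lead to the sign 1; 7 would lead to
      -1.\<close>
    show ?thesis
      using Lu n7 False unfolding nu sign_mod4_def sign_mod8_def mod4_of_mod8[of n]
      by (elim odd_mod8_cases) simp_all
  qed
  obtain \<alpha>0 where \<alpha>0: "int p dvd \<alpha>0\<^sup>2 - int n" using QuadRes_if_Legendre_1[OF Ln] by blast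
  have "\<exists>\<alpha>. m dvd \<alpha>\<^sup>2 - int n"
  proof (cases "c = 2")
    case True
    \<comment> \<open>Adding the odd \<open>p\<close> switches parity, so the root of
      \<open>n\<close> modulo \<open>p\<close> can be made odd, to serve modulo 2 as well.\<close>
    define \<alpha> where "\<alpha> = (if odd \<alpha>0 then \<alpha>0 else \<alpha>0 + int p)"
    have "odd \<alpha>" using p_odd by (simp add: \<alpha>_def)
    then have "2 dvd \<alpha>\<^sup>2 - int n" using n_odd[OF True] by simp
    moreover have "int p dvd \<alpha>\<^sup>2 - int n"
    proof -
      have eq: "(\<alpha>0 + int p)\<^sup>2 - int n = (\<alpha>0\<^sup>2 - int n) + int p * (2 * \<alpha>0 + int p)"
        by (simp add: power2_eq_square algebra_simps)
      have "int p dvd (\<alpha>0 + int p)\<^sup>2 - int n"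
        unfolding eq using \<alpha>0 by (rule dvd_add) simp
      then show ?thesis using \<alpha>0 by (simp add: \<alpha>_def)
    qed
    moreover have "coprime 2 (int p)" using p_odd by simp
    ultimately show ?thesis unfolding m_def True using divides_mult by blast
  next
    case False
    then show ?thesis using \<alpha>0 by (auto simp: m_def c_def split: if_splits)
  qed
  then obtain \<alpha> where \<alpha>: "m dvd \<alpha>\<^sup>2 - int n" by blast
  have "\<exists>b. int (\<Prod>(prime_factors n)) dvd b\<^sup>2 + m"
  proof (rule negated_square_mod_prod)
    fix q assume q: "q \<in> prime_factors n"
    then show "prime q" by auto
    show "\<exists>b. int q dvd b\<^sup>2 + m"
    proof (cases "q = 2")
      case True
      have "even (m\<^sup>2 + m)" by simp
      then show ?thesis using True by auto
    next
      case False
      then have qQ: "q \<in> Q" using q by (simp add: Q_def)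
      have "Legendre (- m) (int q) = \<delta> q * \<delta> q"
        unfolding m_def using Legendre_mult[OF Q(2,3)[OF qQ], of "- c" "int p"] pQ[OF qQ] by (simp add: \<delta>_def)
      then have "Legendre (- m) (int q) = 1" using sign_sq[OF \<delta>[OF qQ]] by simp
      then show ?thesis using QuadRes_if_Legendre_1 by fastforce
    qed
  qed simp
  then obtain \<beta> where \<beta>: "int n dvd \<beta>\<^sup>2 + m"
    using squarefree_eq_prod_prime_factors[OF sf] by metis
  have "coprime (int p) (int n)" using prime_imp_coprime[OF p(1) p_ndvd] by simp
  moreover have "coprime c (int n)" using n_odd by (auto simp: c_def)
  ultimately have cop: "coprime m (int n)" by (simp add: m_def)
  have nonsq: "k\<^sup>2 \<noteq> m" for k
  proof
    assume k: "k\<^sup>2 = m"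
    show False
    proof (cases "c = 2")
      case True
      then have "even (k\<^sup>2)" using k by (simp add: m_def)
      then obtain j where "k = 2 * j" by (auto elim: evenE)
      then have "2 * j\<^sup>2 = int p" using k True by (simp add: m_def)
      then have "even (int p)" by (metis dvd_triv_left)
      then show False using p_odd by simp
    next
      case False
      then have "k\<^sup>2 = int p" using k by (simp add: m_def c_def split: if_splits)
      then show False using square_not_prime[OF p(1)] by blast
    qed
  qed
  obtain t z w where tzw: "t \<noteq> 0" "int n * t\<^sup>2 = z\<^sup>2 + m * w\<^sup>2"
    using legendre_ternary[OF m0 _ cop \<alpha> \<beta> nonsq] n0 by auto
  have "Legendre (-1) (int p) = 1" using Legendre_minus_1[OF p(1,2)] p(3) by (simp add: sign_mod4_def)
  then obtain k where "int p dvd k\<^sup>2 + 1" using QuadRes_if_Legendre_1 by fastforce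
  then obtain x y where xy: "int p = x\<^sup>2 + y\<^sup>2" using prime_sum_two_squares[OF p(1)] by blast
  have "\<exists>x y. m = x\<^sup>2 + y\<^sup>2"
  proof (cases "c = 2")
    case True
    have "m = (x + y)\<^sup>2 + (x - y)\<^sup>2"
      unfolding m_def True xy by (simp add: power2_eq_square algebra_simps)
    then show ?thesis by blast
  next
    case False
    then show ?thesis using xy by (auto simp: m_def c_def split: if_splits)
  qed
  then obtain x y where "m = x\<^sup>2 + y\<^sup>2" by blast
  then have "int n * t\<^sup>2 = z\<^sup>2 + (x * w)\<^sup>2 + (y * w)\<^sup>2"
    using tzw by (simp add: power_mult_distrib algebra_simps)
  then show ?thesis using three_squares_of_rational tzw(1) by blast
qed

text \<open>Squares are 0, 1 or 4 modulo 8, so three never sum to 7; a sum divisible by 4 has only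
  even entries, which strips factors 4. Conversely, since odd squares are 1 modulo 8, the squarefree
  part of \<open>n\<close> is 7 modulo 8 only for the excluded \<open>n\<close>.\<close>

lemma sum_of_three_squares_iff:
  fixes n :: nat
  shows "(\<exists>a b c :: int. int n = a\<^sup>2 + b\<^sup>2 + c\<^sup>2) \<longleftrightarrow> \<not> (\<exists>k m. n = 4 ^ k * (8 * m + 7))"
proof
  assume "\<exists>a b c :: int. int n = a\<^sup>2 + b\<^sup>2 + c\<^sup>2"
  then obtain a b c :: int where abc: "int n = a\<^sup>2 + b\<^sup>2 + c\<^sup>2" by blast
  have mod_add3: "(x + y + z) mod k = (x mod k + y mod k + z mod k) mod k" for x y z k :: int
    by (metis mod_add_eq mod_add_left_eq)
  have "a\<^sup>2 + b\<^sup>2 + c\<^sup>2 \<noteq> 4 ^ k * (8 * int m + 7)" for k m and a b c :: int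
  proof (induction k arbitrary: a b c)
    case 0
    have sq: "x\<^sup>2 mod 8 \<in> {0, 1, 4}" for x :: int
    proof -
      have "x mod 8 \<in> {0, 1, 2, 3, 4, 5, 6, 7}" by (simp, presburger)
      moreover have "x\<^sup>2 mod 8 = (x mod 8)\<^sup>2 mod 8" by (simp add: power_mod)
      ultimately show ?thesis by auto
    qed
    have "(a\<^sup>2 + b\<^sup>2 + c\<^sup>2) mod 8 = (a\<^sup>2 mod 8 + b\<^sup>2 mod 8 + c\<^sup>2 mod 8) mod 8"
      by (rule mod_add3)
    then have "(a\<^sup>2 + b\<^sup>2 + c\<^sup>2) mod 8 \<noteq> 7" using sq[of a] sq[of b] sq[of c] by auto
    moreover have "(8 * int m + 7) mod 8 = 7" by presburger
    ultimately show ?case by fastforce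
  next
    case (Suc k)
    show ?case
    proof
      assume eq: "a\<^sup>2 + b\<^sup>2 + c\<^sup>2 = 4 ^ Suc k * (8 * int m + 7)"
      have sq: "x\<^sup>2 mod 4 = (if even x then 0 else 1)" for x :: int
      proof -
        have "x\<^sup>2 mod 4 = (x mod 4)\<^sup>2 mod 4" by (simp add: power_mod)
        moreover have "x mod 4 = 0 \<and> even x \<or> x mod 4 = 1 \<and> odd x \<or> x mod 4 = 2 \<and> even x \<or> x mod 4 = 3 \<and> odd x"
          by presburger
        ultimately show ?thesis by auto
      qed
      have "(a\<^sup>2 + b\<^sup>2 + c\<^sup>2) mod 4 = (a\<^sup>2 mod 4 + b\<^sup>2 mod 4 + c\<^sup>2 mod 4) mod 4"
        by (rule mod_add3)
      moreover have "(a\<^sup>2 + b\<^sup>2 + c\<^sup>2) mod 4 = 0" unfolding eq by simp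
      ultimately have "even a" "even b" "even c"
        unfolding sq by (auto split: if_splits)
      then obtain a' b' c' where "a = 2 * a'" "b = 2 * b'" "c = 2 * c'" by (auto elim!: evenE)
      then have "a'\<^sup>2 + b'\<^sup>2 + c'\<^sup>2 = 4 ^ k * (8 * int m + 7)" using eq by (simp add: power_mult_distrib)
      then show False using Suc by blast
    qed
  qed
  from this[of a b c] show "\<not> (\<exists>k m. n = 4 ^ k * (8 * m + 7))"
    unfolding abc[symmetric] by (auto simp flip: of_nat_eq_iff[where 'a = int])
next
  assume not_form: "\<not> (\<exists>k m. n = 4 ^ k * (8 * m + 7))"
  show "\<exists>a b c :: int. int n = a\<^sup>2 + b\<^sup>2 + c\<^sup>2"
  proof (cases "n = 0")
    case True
    then show ?thesis by (intro exI[of _ 0]) simp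
  next
    case False
    define f where "f = squarefree_part n"
    define s where "s = square_part n"
    have n: "n = f * s\<^sup>2" unfolding f_def s_def by (rule squarefree_decompose)
    have "f mod 8 \<noteq> 7"
    proof
      assume f7: "f mod 8 = 7"
      have "s \<noteq> 0" using n False by auto
      then obtain o' where o': "s = 2 ^ multiplicity 2 s * o'" "\<not> 2 dvd o'"
        using multiplicity_decompose'[of s "2::nat"] by auto
      have "o' mod 8 = 1 \<or> o' mod 8 = 3 \<or> o' mod 8 = 5 \<or> o' mod 8 = 7" using o'(2) by presburger
      moreover have "o'\<^sup>2 mod 8 = (o' mod 8)\<^sup>2 mod 8" by (simp add: power_mod)
      ultimately have "o'\<^sup>2 mod 8 = 1" by auto
      then have "(f * o'\<^sup>2) mod 8 = 7" using f7 by (metis mod_mult_eq mult_1_right mod_mod_trivial)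
      then have "f * o'\<^sup>2 = 8 * (f * o'\<^sup>2 div 8) + 7" by (metis mult_div_mod_eq)
      moreover have "n = 4 ^ multiplicity 2 s * (f * o'\<^sup>2)"
      proof -
        have "s\<^sup>2 = (2 ^ multiplicity 2 s)\<^sup>2 * o'\<^sup>2" by (subst o'(1)) (rule power_mult_distrib)
        also have "((2::nat) ^ multiplicity 2 s)\<^sup>2 = 4 ^ multiplicity 2 s"
          by (simp add: power2_eq_square flip: power_mult_distrib)
        finally show ?thesis using n by simp
      qed
      ultimately show False using not_form by metis
    qed
    then obtain a b c where "int f = a\<^sup>2 + b\<^sup>2 + c\<^sup>2"
      using three_squares_squarefree[of f] by (auto simp: f_def)
    then have "int n = (a * int s)\<^sup>2 + (b * int s)\<^sup>2 + (c * int s)\<^sup>2"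
      using n by (simp add: power_mult_distrib algebra_simps)
    then show ?thesis by blast
  qed
qed

section \<open>From three squares to propus parameters\<close>

text \<open>
  Completing squares turns the propus equations for \<open>v = 2 w\<close> into
  \<open>(w - x)\<^sup>2 + 2 (w - y)\<^sup>2 + (w - z)\<^sup>2 = 2 w\<close>. Here \<open>w - x\<close> and \<open>w - z\<close> have the same parity,
  so they are a sum \<open>s + t\<close> and a difference \<open>s - t\<close>, and \<open>w = s\<^sup>2 + (w - y)\<^sup>2 + t\<^sup>2\<close>.
\<close>

lemma propus_iff_three_squares:
  fixes w :: nat
  assumes w: "w > 0"
  shows "(\<exists>x y z l. propus_parameter_set (2 * w) x y z l \<and> x \<le> w \<and> y \<le> w \<and> z \<le> w)
    \<longleftrightarrow> (\<exists>a b c :: int. int w = a\<^sup>2 + b\<^sup>2 + c\<^sup>2)"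
proof
  assume "\<exists>x y z l. propus_parameter_set (2 * w) x y z l \<and> x \<le> w \<and> y \<le> w \<and> z \<le> w"
  then obtain x y z l where P: "propus_parameter_set (2 * w) x y z l" by blast
  define a b c where "a = int w - int x" and "b = int w - int y" and "c = int w - int z"
  have l: "int l = int x + int y + int y + int z - 2 * int w"
    and eq: "int x * (int x - 1) + int y * (int y - 1) + int y * (int y - 1) + int z * (int z - 1)
      = int l * (2 * int w - 1)"
    using P by (auto simp: propus_parameter_set_def GS_parameter_set_def)
  have sum: "a\<^sup>2 + 2 * b\<^sup>2 + c\<^sup>2 = 2 * int w"
    using eq unfolding l a_def b_def c_def by (simp add: power2_eq_square algebra_simps)
  have "a\<^sup>2 + c\<^sup>2 = 2 * (int w - b\<^sup>2)" using sum by simp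
  then have "even (a\<^sup>2 + c\<^sup>2)" by simp
  then have "even (a + c)" by simp
  then obtain s where s: "a + c = 2 * s" by (rule evenE)
  define t where "t = s - c"
  have ac: "a = s + t" "c = s - t" using s by (auto simp: t_def)
  have "2 * (s\<^sup>2 + b\<^sup>2 + t\<^sup>2) = 2 * int w"
    using sum unfolding ac by (simp add: power2_eq_square algebra_simps)
  then have "int w = s\<^sup>2 + b\<^sup>2 + t\<^sup>2" by simp
  then show "\<exists>a b c :: int. int w = a\<^sup>2 + b\<^sup>2 + c\<^sup>2" by blast
next
  assume "\<exists>a b c :: int. int w = a\<^sup>2 + b\<^sup>2 + c\<^sup>2"
  then obtain s b0 t :: int where w_eq: "int w = s\<^sup>2 + b0\<^sup>2 + t\<^sup>2" by blast
  \<comment> \<open>The signs are free; nonnegative values ensure that \<open>x\<close>,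
    \<open>y\<close> and \<open>z\<close> are at most \<open>w\<close>.\<close>
  define a b c where "a = \<bar>s + t\<bar>" and "b = \<bar>b0\<bar>" and "c = \<bar>s - t\<bar>"
  have sum: "a\<^sup>2 + 2 * b\<^sup>2 + c\<^sup>2 = 2 * int w"
    unfolding a_def b_def c_def w_eq power2_abs by (simp add: power2_eq_square algebra_simps)
  have nonneg: "a \<ge> 0" "b \<ge> 0" "c \<ge> 0" by (simp_all add: a_def b_def c_def)
  \<comment> \<open>Makes \<open>w - a\<close>, \<open>w - b\<close> and \<open>w - c\<close>
    nonnegative: the squares are at most \<open>2 * w\<close>, and \<open>(w + 1)^2\<close> exceeds
    that.\<close>
  have le: "k \<le> int w" if "k\<^sup>2 \<le> 2 * int w" for k
  proof (rule ccontr)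
    assume "\<not> k \<le> int w"
    then have "(int w + 1)\<^sup>2 \<le> k\<^sup>2" by (intro power_mono) auto
    moreover have "(int w + 1)\<^sup>2 = (int w)\<^sup>2 + 2 * int w + 1" by (simp add: power2_eq_square algebra_simps)
    ultimately show False using that by (smt (verit) zero_le_power2)
  qed
  have abc_le: "a \<le> int w" "b \<le> int w" "c \<le> int w"
    using le sum zero_le_power2[of a] zero_le_power2[of b] zero_le_power2[of c] by smt+
  have self_le_square: "k \<le> k\<^sup>2" if "k \<ge> 0" for k :: int
  proof (cases "k = 0")
    case False
    then have "k * 1 \<le> k * k" using that by (intro mult_left_mono) auto
    then show ?thesis by (simp add: power2_eq_square)
  qed simp
  \<comment> \<open>The difference of the two sides is the future \<open>l\<close>; it is
    nonnegative because each entry is at most its square.\<close>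
  have l_nonneg: "a + 2 * b + c \<le> 2 * int w"
    using self_le_square nonneg sum by (smt (verit))
  define x y z l where "x = nat (int w - a)" and "y = nat (int w - b)" and "z = nat (int w - c)"
    and "l = nat (2 * int w - (a + 2 * b + c))"
  have ints: "int x = int w - a" "int y = int w - b" "int z = int w - c"
    "int l = 2 * int w - (a + 2 * b + c)"
    using abc_le l_nonneg by (simp_all add: x_def y_def z_def l_def)
  have "propus_parameter_set (2 * w) x y z l"
    unfolding propus_parameter_set_def GS_parameter_set_def
  proof (intro conjI)
    have "int x * (int x - 1) + int y * (int y - 1) + int y * (int y - 1) + int z * (int z - 1)
        - int l * (2 * int w - 1) = (a\<^sup>2 + 2 * b\<^sup>2 + c\<^sup>2) - 2 * int w"
      unfolding ints by (simp add: power2_eq_square algebra_simps)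
    then show "int x * (int x - 1) + int y * (int y - 1) + int y * (int y - 1) + int z * (int z - 1)
        = int l * (int (2 * w) - 1)"
      using sum by simp
  qed (use w ints in auto)
  moreover have "x \<le> w" "y \<le> w" "z \<le> w" using ints nonneg by linarith+
  ultimately show "\<exists>x y z l. propus_parameter_set (2 * w) x y z l \<and> x \<le> w \<and> y \<le> w \<and> z \<le> w"
    by blast
qed

theorem theorem2:
  fixes v :: nat
  assumes "even v" and "v > 0"
  shows "(\<exists>x y z l :: nat. propus_parameter_set v x y z l \<and>
            x \<le> v div 2 \<and> y \<le> v div 2 \<and> z \<le> v div 2)
         \<longleftrightarrow> \<not> (\<exists>k m :: nat. v = 2 ^ (2 * k + 1) * (8 * m + 7))"
proof -
  obtain w where v: "v = 2 * w" using assms(1) by (auto elim: evenE)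
  then have "w > 0" using assms(2) by simp
  have "(v = 2 ^ (2 * k + 1) * (8 * m + 7)) \<longleftrightarrow> (w = 4 ^ k * (8 * m + 7))" for k m :: nat
    by (simp add: v power_mult)
  then show ?thesis
    using propus_iff_three_squares[OF \<open>w > 0\<close>] sum_of_three_squares_iff[of w] by (simp add: v)
qed

end
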